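(* Let $(E,\rho,\langle\cdot,\cdot\rangle,\circ)$ be a Courant algebroid endowed with a complex structure $J$. Assume that $\Omega\in\Gamma(\wedge^2L_J)$ is a holomorphic symplectic structure on $E$ with respect to $J$, and set $I=\Omega^\sharp+\overline{\Omega}^\sharp$ and $K=-\sqrt{-1}(\Omega^\sharp-\overline{\Omega}^\sharp)$. Let $L$ be a Lie subalgebroid of $L_J^*$ which is Lagrangian with respect to $\Omega$. Then the hypercomplex connection $\nabla$ given by $$\nabla_{U}V=-\tfrac{1}{2}K\big(JV\circ IU-J(V\circ IU)-I(JV\circ U)+JI(V\circ U)\big)$$ (extended $\mathbb{C}$-bilinearly to sections of $E\otimes\mathbb{C}$) induces a torsion-free flat $L$-connection $\nabla|_L$ on $L$.
   Context: A Courant algebroid $(E,\rho,\langle\cdot,\cdot\rangle,\circ)$ over a smooth manifold $M$ is a real vector bundle $E\to M$ with a nondegenerate symmetric pairing $\langle\cdot,\cdot\rangle$ on the fibres, a bundle map $\rho:E\to TM$ (anchor) and an $\mathbb{R}$-bilinear operation $\circ$ on $\Gamma(E)$ (Dorfman bracket) such that for all $f\in C^\infty(M)$, $x,y,z\in\Gamma(E)$: $x\circ(y\circ z)=(x\circ y)\circ z+y\circ(x\circ z)$; $\rho(x\circ y)=[\rho(x),\rho(y)]$; $x\circ fy=(\rho(x)f)y+f(x\circ y)$; $x\circ y+y\circ x=2\mathcal{D}\langle x,y\rangle$; $\mathcal{D}f\circ x=0$; $\rho(x)\langle y,z\rangle=\langle x\circ y,z\rangle+\langle y,x\circ z\rangle$;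 where $\langle\mathcal{D}f,x\rangle=\frac12\rho(x)f$. All structures are extended $\mathbb{C}$-linearly to $E_{\mathbb{C}}=E\otimes\mathbb{C}$. A complex structure on $E$ is a vector bundle endomorphism $J$ of $E$, orthogonal for $\langle\cdot,\cdot\rangle$, with $J^2=-1$ and $\mathcal{N}(J,J)=0$, where $\frac12\mathcal{N}(J,J)(U,V)=JU\circ JV-J(U\circ JV)-J(JU\circ V)+J^2(U\circ V)$. $L_J$ and $\overline{L_J}$ are its $+\sqrt{-1}$ and $-\sqrt{-1}$ eigenbundles in $E_{\mathbb{C}}$; $\overline{L_J}$ is identified with $L_J^*$ via $\langle\cdot,\cdot\rangle$. With the restrictions of $\rho$ and $\circ$, $L_J$ and $L_J^*$ are (complex) Lie algebroids; $d_{L_J^*}:\Gamma(\wedge^kL_J)\to\Gamma(\wedge^{k+1}L_J)$ is the Lie algebroid differential of $L_J^*$ (with $L_J\cong(L_J^* )^*$ via $\langle\cdot,\cdot\rangle$). Elements of $\wedge^kE_{\mathbb{C}}$ are viewed in $\wedge^kE_{\mathbb{C}}^*$ via $e\mapsto\langle e,\cdot\rangle$. For $\Omega\in\Gamma(\wedge^2E_{\mathbb{C}}^* )$, $\Omega^\sharp$ is defined by $\Omega(U,V)=\langle\Omega^\sharp U,V\rangle$. A holomorphic symplectic structure on $E$ with respect to $J$ is a section $\Omega$ of $\wedge^2L_J$ with $d_{L_J^*}\Omega=0$ and $\Omega^\sharp\overline{\Omega}^\sharp+\overline{\Omega}^\sharp\Omega^\sharp=-\mathrm{id}_{E_{\mathbb{C}}}$.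 (The triple $(I,J,K)$ above is then a hypercomplex structure on $E$.) A Lie subalgebroid $L$ of $L_J^*$ (a subbundle whose sections are closed under the bracket) is Lagrangian with respect to $\Omega$ if it is maximal isotropic with respect to $\Omega$. For a Lie algebroid $L$ with anchor $\rho$ over $M$ and a vector bundle $V\to M$, an $L$-connection on $V$ is a bilinear map $\nabla:\Gamma(L)\times\Gamma(V)\to\Gamma(V)$ with $\nabla_{fX}v=f\nabla_Xv$ and $\nabla_X(fv)=f\nabla_Xv+(\rho(X)f)v$. An $L$-connection on $L$ is torsion-free if $\nabla_XY-\nabla_YX=[X,Y]$, and flat if $\nabla_X\nabla_YZ-\nabla_Y\nabla_XZ-\nabla_{[X,Y]}Z=0$, for all sections $X,Y,Z$ of $L$. That $\nabla$ induces an $L$-connection on $L$ means that $\nabla_\xi\eta\in\Gamma(L)$ for all $\xi,\eta\in\Gamma(L)$ and that $(\xi,\eta)\mapsto\nabla_\xi\eta$ is an $L$-connection on $L$. *)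

theory Defs
  imports "HOL-Analysis.Analysis"
begin

section \<open>Smooth functions and smooth manifolds\<close>

text \<open>
  \<open>ck_on k S f\<close>: \<open>f\<close> is of class \<open>C\<^sup>k\<close> on \<open>S\<close>. It is only used on open subsets \<open>S\<close> of a
  finite-dimensional space, where it only depends on the restriction of \<open>f\<close> to \<open>S\<close>.
\<close>

primrec ck_on :: "nat \<Rightarrow> 'a::real_normed_vector set \<Rightarrow> ('a \<Rightarrow> 'b::real_normed_vector) \<Rightarrow> bool" where
  "ck_on 0 S f \<longleftrightarrow> continuous_on S f"
| "ck_on (Suc k) S f \<longleftrightarrow>
     (\<forall>x\<in>S. f differentiable (at x)) \<and> (\<forall>v. ck_on k S (\<lambda>x. frechet_derivative f (at x) v))"

definition smooth_on :: "'a::real_normed_vector set \<Rightarrow> ('a \<Rightarrow> 'b::real_normed_vector) \<Rightarrow> bool" where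
  "smooth_on S f \<longleftrightarrow> (\<forall>k. ck_on k S f)"

text \<open>
  The points of a manifold are all elements of the type \<open>'m\<close>. The model space \<open>'c\<close> is a
  finite-dimensional real inner product space; the class \<^class>\<open>euclidean_space\<close> would exclude
  manifolds of dimension 0. A chart is a pair of its domain and its coordinate map.
\<close>

record ('m, 'c) manifold =
  charts :: "('m set \<times> ('m \<Rightarrow> 'c)) set"

definition is_chart :: "'m::topological_space set \<times> ('m \<Rightarrow> 'c::real_inner) \<Rightarrow> bool" where
  "is_chart = (\<lambda>(U, \<phi>). open U \<and> open (\<phi> ` U) \<and> (\<exists>\<psi>. homeomorphism U (\<phi> ` U) \<phi> \<psi>))"

locale smooth_manifold =
  fixes M :: "('m::{second_countable_topology, t2_space}, 'c::real_inner, 'z) manifold_scheme"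
  assumes finite_dim: "\<exists>B::'c set. finite B \<and> span B = UNIV"
    and charts: "\<kappa> \<in> charts M \<Longrightarrow> is_chart \<kappa>"
    and charts_cover: "(\<Union>(U, \<phi>)\<in>charts M. U) = UNIV"
    and charts_compatible: "(U, \<phi>) \<in> charts M \<Longrightarrow> (V, \<psi>) \<in> charts M \<Longrightarrow>
      smooth_on (\<phi> ` (U \<inter> V)) (\<psi> \<circ> inv_into U \<phi>)"

text \<open>Smoothness of a function on an open set \<open>U\<close> of the manifold.\<close>

definition smooth_fun_on ::
  "('m, 'c::real_inner, 'z) manifold_scheme \<Rightarrow> 'm set \<Rightarrow> ('m \<Rightarrow> 'b::real_normed_vector) \<Rightarrow> bool" where
  "smooth_fun_on M U f \<longleftrightarrow> (\<forall>(V, \<phi>)\<in>charts M. smooth_on (\<phi> ` (U \<inter> V)) (f \<circ> inv_into V \<phi>))"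

text \<open>Used with values in \<^typ>\<open>real\<close> for \<open>C\<^sup>\<infinity>(M)\<close> and in \<^typ>\<open>complex\<close> for \<open>C\<^sup>\<infinity>(M) \<otimes> \<complex>\<close>.\<close>

definition smooth_funs ::
  "('m, 'c::real_inner, 'z) manifold_scheme \<Rightarrow> ('m \<Rightarrow> 'b::real_normed_vector) set" where
  "smooth_funs M = {f. smooth_fun_on M UNIV f}"

text \<open>
  Tangent vectors at \<open>p\<close> are derivations at \<open>p\<close> of the algebra of smooth functions. Their values on
  functions that are not smooth carry no information and are never used.
\<close>

definition tangent_vector ::
  "('m, 'c::real_inner, 'z) manifold_scheme \<Rightarrow> 'm \<Rightarrow> (('m \<Rightarrow> real) \<Rightarrow> real) \<Rightarrow> bool" where
  "tangent_vector M p D \<longleftrightarrow>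
     (\<forall>f\<in>smooth_funs M. \<forall>g\<in>smooth_funs M. D (\<lambda>q. f q + g q) = D f + D g) \<and>
     (\<forall>a. \<forall>f\<in>smooth_funs M. D (\<lambda>q. a * f q) = a * D f) \<and>
     (\<forall>f\<in>smooth_funs M. \<forall>g\<in>smooth_funs M. D (\<lambda>q. f q * g q) = f p * D g + g p * D f)"


section \<open>Vector bundles\<close>

text \<open>
  The fibres of a bundle are linear subspaces of one ambient vector space \<open>'v\<close>, which is only a
  container (for an abstract bundle take, for instance, the direct sum of all its fibres): it has
  no topology, and the fibres over different points are unrelated. The smooth structure is given
  by a family of local frames \<open>(V, r, e)\<close>, i.e. local trivialisations \<open>V \<times> \<real>\<^sup>r\<close> with the frame
  \<open>e 0, \<dots>, e (r - 1)\<close> on the open set \<open>V\<close>; the rank is locally constant.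
\<close>

record ('m, 'c, 'v) vbundle = "('m, 'c) manifold" +
  fibre :: "'m \<Rightarrow> 'v set"
  frames :: "('m set \<times> nat \<times> (nat \<Rightarrow> 'm \<Rightarrow> 'v)) set"

text \<open>Smooth sections over an open set \<open>U\<close>: the coefficients in every local frame are smooth.\<close>

definition sections_on ::
  "('m, 'c::real_inner, 'v::real_vector, 'z) vbundle_scheme \<Rightarrow> 'm set \<Rightarrow> ('m \<Rightarrow> 'v) set" where
  "sections_on E U = {s. (\<forall>p\<in>U. s p \<in> fibre E p) \<and>
     (\<forall>(V, r, e)\<in>frames E. \<exists>c. (\<forall>i<r. smooth_fun_on E (U \<inter> V) (c i)) \<and>
        (\<forall>p\<in>U \<inter> V. s p = (\<Sum>i<r. (c i p :: real) *\<^sub>R e i p)))}"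

abbreviation sections ::
  "('m, 'c::real_inner, 'v::real_vector, 'z) vbundle_scheme \<Rightarrow> ('m \<Rightarrow> 'v) set" where
  "sections E \<equiv> sections_on E UNIV"

text \<open>The last assumption says that the transition matrices between local frames are smooth.\<close>

locale vector_bundle = smooth_manifold E
  for E :: "('m::{second_countable_topology, t2_space}, 'c::real_inner, 'v::real_vector, 'z) vbundle_scheme" +
  assumes subspace_fibre: "subspace (fibre E p)"
    and frames_open: "(V, r, e) \<in> frames E \<Longrightarrow> open V"
    and frames_cover: "(\<Union>(V, r, e)\<in>frames E. V) = UNIV"
    and frames_basis: "(V, r, e) \<in> frames E \<Longrightarrow> p \<in> V \<Longrightarrow>
      inj_on (\<lambda>i. e i p) {..<r} \<and> independent ((\<lambda>i. e i p) ` {..<r}) \<and>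
      span ((\<lambda>i. e i p) ` {..<r}) = fibre E p"
    and frames_smooth: "(V, r, e) \<in> frames E \<Longrightarrow> i < r \<Longrightarrow> e i \<in> sections_on E V"

definition linear_on :: "'a::real_vector set \<Rightarrow> ('a \<Rightarrow> 'b::real_vector) \<Rightarrow> bool" where
  "linear_on S g \<longleftrightarrow> (\<forall>u\<in>S. \<forall>v\<in>S. g (u + v) = g u + g v) \<and> (\<forall>a. \<forall>u\<in>S. g (a *\<^sub>R u) = a *\<^sub>R g u)"


section \<open>Courant algebroids\<close>

record ('m, 'c, 'v) courant = "('m, 'c, 'v) vbundle" +
  anchor :: "'m \<Rightarrow> 'v \<Rightarrow> ('m \<Rightarrow> real) \<Rightarrow> real"
  pairing :: "'m \<Rightarrow> 'v \<Rightarrow> 'v \<Rightarrow> real"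
  dorfman :: "('m \<Rightarrow> 'v) \<Rightarrow> ('m \<Rightarrow> 'v) \<Rightarrow> ('m \<Rightarrow> 'v)"

abbreviation anchor_der where  \<comment> \<open>the function \<open>\<rho>(x)f\<close>\<close>
  "anchor_der E x f \<equiv> (\<lambda>p. anchor E p (x p) f)"

abbreviation pairing_fun where  \<comment> \<open>the function \<open>\<langle>x, y\<rangle>\<close>\<close>
  "pairing_fun E x y \<equiv> (\<lambda>p. pairing E p (x p) (y p))"

text \<open>The section \<open>\<D>f\<close> with \<open>\<langle>\<D>f, x\<rangle> = \<rho>(x)f / 2\<close>.\<close>

definition courant_D ::
  "('m, 'c::real_inner, 'v::real_vector, 'z) courant_scheme \<Rightarrow> ('m \<Rightarrow> real) \<Rightarrow> ('m \<Rightarrow> 'v)" where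
  "courant_D E f = (\<lambda>p. THE w. w \<in> fibre E p \<and> (\<forall>v\<in>fibre E p. pairing E p w v = anchor E p v f / 2))"

locale courant_algebroid = vector_bundle E
  for E :: "('m::{second_countable_topology, t2_space}, 'c::real_inner, 'v::real_vector, 'z) courant_scheme" +
  assumes \<comment> \<open>the pairing is a smooth, symmetric, nondegenerate bilinear form on the fibres\<close>
    pairing_sym: "u \<in> fibre E p \<Longrightarrow> v \<in> fibre E p \<Longrightarrow> pairing E p u v = pairing E p v u"
    and pairing_linear: "v \<in> fibre E p \<Longrightarrow> linear_on (fibre E p) (\<lambda>u. pairing E p u v)"
    and pairing_nondegenerate:
      "u \<in> fibre E p \<Longrightarrow> (\<And>v. v \<in> fibre E p \<Longrightarrow> pairing E p u v = 0) \<Longrightarrow> u = 0"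
    and pairing_smooth:
      "open U \<Longrightarrow> x \<in> sections_on E U \<Longrightarrow> y \<in> sections_on E U \<Longrightarrow> smooth_fun_on E U (pairing_fun E x y)"
    \<comment> \<open>the anchor is a bundle map to the tangent bundle (a vector field \<open>X\<close> is smooth iff \<open>X f\<close> is
        smooth for all smooth \<open>f\<close>)\<close>
    and anchor_tangent: "u \<in> fibre E p \<Longrightarrow> tangent_vector E p (anchor E p u)"
    and anchor_linear: "f \<in> smooth_funs E \<Longrightarrow> linear_on (fibre E p) (\<lambda>u. anchor E p u f)"
    and anchor_smooth: "open U \<Longrightarrow> x \<in> sections_on E U \<Longrightarrow> f \<in> smooth_funs E \<Longrightarrow>
      smooth_fun_on E U (anchor_der E x f)"
    \<comment> \<open>the Dorfman bracket is a real bilinear operation on sections\<close>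
    and dorfman_closed: "x \<in> sections E \<Longrightarrow> y \<in> sections E \<Longrightarrow> dorfman E x y \<in> sections E"
    and dorfman_add_left: "x \<in> sections E \<Longrightarrow> y \<in> sections E \<Longrightarrow> z \<in> sections E \<Longrightarrow>
      dorfman E (\<lambda>p. x p + y p) z = (\<lambda>p. dorfman E x z p + dorfman E y z p)"
    and dorfman_add_right: "x \<in> sections E \<Longrightarrow> y \<in> sections E \<Longrightarrow> z \<in> sections E \<Longrightarrow>
      dorfman E x (\<lambda>p. y p + z p) = (\<lambda>p. dorfman E x y p + dorfman E x z p)"
    and dorfman_scale_left: "x \<in> sections E \<Longrightarrow> y \<in> sections E \<Longrightarrow>
      dorfman E (\<lambda>p. a *\<^sub>R x p) y = (\<lambda>p. a *\<^sub>R dorfman E x y p)"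
    and dorfman_scale_right: "x \<in> sections E \<Longrightarrow> y \<in> sections E \<Longrightarrow>
      dorfman E x (\<lambda>p. a *\<^sub>R y p) = (\<lambda>p. a *\<^sub>R dorfman E x y p)"
    \<comment> \<open>the Courant algebroid axioms\<close>
    and dorfman_jacobi: "x \<in> sections E \<Longrightarrow> y \<in> sections E \<Longrightarrow> z \<in> sections E \<Longrightarrow>
      dorfman E x (dorfman E y z) = (\<lambda>p. dorfman E (dorfman E x y) z p + dorfman E y (dorfman E x z) p)"
    and anchor_dorfman: "x \<in> sections E \<Longrightarrow> y \<in> sections E \<Longrightarrow> f \<in> smooth_funs E \<Longrightarrow>
      anchor_der E (dorfman E x y) f =
        (\<lambda>p. anchor_der E x (anchor_der E y f) p - anchor_der E y (anchor_der E x f) p)"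
    and dorfman_leibniz: "x \<in> sections E \<Longrightarrow> y \<in> sections E \<Longrightarrow> f \<in> smooth_funs E \<Longrightarrow>
      dorfman E x (\<lambda>p. f p *\<^sub>R y p) = (\<lambda>p. anchor_der E x f p *\<^sub>R y p + f p *\<^sub>R dorfman E x y p)"
    and dorfman_symmetric_part: "x \<in> sections E \<Longrightarrow> y \<in> sections E \<Longrightarrow>
      (\<lambda>p. dorfman E x y p + dorfman E y x p) = (\<lambda>p. 2 *\<^sub>R courant_D E (pairing_fun E x y) p)"
    and dorfman_D: "x \<in> sections E \<Longrightarrow> f \<in> smooth_funs E \<Longrightarrow> dorfman E (courant_D E f) x = (\<lambda>p. 0)"
    and dorfman_pairing: "x \<in> sections E \<Longrightarrow> y \<in> sections E \<Longrightarrow> z \<in> sections E \<Longrightarrow>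
      anchor_der E x (pairing_fun E y z) =
        (\<lambda>p. pairing_fun E (dorfman E x y) z p + pairing_fun E y (dorfman E x z) p)"


section \<open>Complexification\<close>

text \<open>
  The complexification of the real vector space \<open>'v\<close> is \<open>'v \<times> 'v\<close>, where \<open>(a, b)\<close> stands for
  \<open>a + \<i> b\<close>.
\<close>

definition cscale :: "complex \<Rightarrow> 'v::real_vector \<times> 'v \<Rightarrow> 'v \<times> 'v" (infixr "*\<^sub>C" 75) where
  "c *\<^sub>C w = (Re c *\<^sub>R fst w - Im c *\<^sub>R snd w, Re c *\<^sub>R snd w + Im c *\<^sub>R fst w)"

global_interpretation cvec: vector_space "cscale :: complex \<Rightarrow> 'v::real_vector \<times> 'v \<Rightarrow> 'v \<times> 'v"
  defines csubspace = cvec.subspace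
    and cdependent = cvec.dependent
    and cspan = cvec.span
  by unfold_locales (auto simp: cscale_def prod_eq_iff algebra_simps)

definition conj_vec :: "'v \<times> 'v \<Rightarrow> 'v::real_vector \<times> 'v" where
  "conj_vec w = (fst w, - snd w)"

definition cfibre :: "('m, 'c, 'v, 'z) vbundle_scheme \<Rightarrow> 'm \<Rightarrow> ('v \<times> 'v) set" where
  "cfibre E p = fibre E p \<times> fibre E p"

text \<open>
  Smooth sections over \<open>U\<close> of \<open>E \<otimes> \<complex>\<close> with values in the subspaces \<open>B p\<close> of its fibres.
\<close>

definition csections_on ::
  "('m, 'c::real_inner, 'v::real_vector, 'z) vbundle_scheme \<Rightarrow> ('m \<Rightarrow> ('v \<times> 'v) set) \<Rightarrow> 'm set
     \<Rightarrow> ('m \<Rightarrow> 'v \<times> 'v) set" where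
  "csections_on E B U =
     {s. fst \<circ> s \<in> sections_on E U \<and> snd \<circ> s \<in> sections_on E U \<and> (\<forall>p\<in>U. s p \<in> B p)}"

abbreviation csections ::
  "('m, 'c::real_inner, 'v::real_vector, 'z) vbundle_scheme \<Rightarrow> ('m \<Rightarrow> ('v \<times> 'v) set)
     \<Rightarrow> ('m \<Rightarrow> 'v \<times> 'v) set" where
  "csections E B \<equiv> csections_on E B UNIV"

text \<open>The \<open>\<complex>\<close>-linear extensions of the structure maps of \<open>E\<close>.\<close>

definition cpairing ::
  "('m, 'c, 'v::real_vector, 'z) courant_scheme \<Rightarrow> 'm \<Rightarrow> 'v \<times> 'v \<Rightarrow> 'v \<times> 'v \<Rightarrow> complex" where
  "cpairing E p u v =
     Complex (pairing E p (fst u) (fst v) - pairing E p (snd u) (snd v))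
             (pairing E p (fst u) (snd v) + pairing E p (snd u) (fst v))"

definition canchor ::
  "('m, 'c, 'v::real_vector, 'z) courant_scheme \<Rightarrow> 'm \<Rightarrow> 'v \<times> 'v \<Rightarrow> ('m \<Rightarrow> complex) \<Rightarrow> complex" where
  "canchor E p u f =
     Complex (anchor E p (fst u) (Re \<circ> f) - anchor E p (snd u) (Im \<circ> f))
             (anchor E p (fst u) (Im \<circ> f) + anchor E p (snd u) (Re \<circ> f))"

abbreviation canchor_der where
  "canchor_der E x f \<equiv> (\<lambda>p. canchor E p (x p) f)"

definition cdorfman ::
  "('m, 'c, 'v::real_vector, 'z) courant_scheme
     \<Rightarrow> ('m \<Rightarrow> 'v \<times> 'v) \<Rightarrow> ('m \<Rightarrow> 'v \<times> 'v) \<Rightarrow> ('m \<Rightarrow> 'v \<times> 'v)" where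
  "cdorfman E x y = (\<lambda>p.
     (dorfman E (fst \<circ> x) (fst \<circ> y) p - dorfman E (snd \<circ> x) (snd \<circ> y) p,
      dorfman E (fst \<circ> x) (snd \<circ> y) p + dorfman E (snd \<circ> x) (fst \<circ> y) p))"

definition cextend :: "('m \<Rightarrow> 'v \<Rightarrow> 'v) \<Rightarrow> 'm \<Rightarrow> 'v \<times> 'v \<Rightarrow> 'v \<times> 'v" where
  "cextend J p u = (J p (fst u), J p (snd u))"


section \<open>Complex structures\<close>

text \<open>A fibrewise map \<open>A\<close> applied to a section.\<close>

abbreviation app_section :: "('m \<Rightarrow> 'a \<Rightarrow> 'b) \<Rightarrow> ('m \<Rightarrow> 'a) \<Rightarrow> 'm \<Rightarrow> 'b" (infixr "\<bullet>\<^sub>s" 80) where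
  "A \<bullet>\<^sub>s s \<equiv> (\<lambda>p. A p (s p))"

definition nijenhuis ::
  "('m, 'c, 'v::real_vector, 'z) courant_scheme \<Rightarrow> ('m \<Rightarrow> 'v \<Rightarrow> 'v) \<Rightarrow> ('m \<Rightarrow> 'v) \<Rightarrow> ('m \<Rightarrow> 'v) \<Rightarrow> ('m \<Rightarrow> 'v)"
  where
  "nijenhuis E J x y = (\<lambda>p. 2 *\<^sub>R
     (dorfman E (J \<bullet>\<^sub>s x) (J \<bullet>\<^sub>s y) p - (J \<bullet>\<^sub>s dorfman E x (J \<bullet>\<^sub>s y)) p
        - (J \<bullet>\<^sub>s dorfman E (J \<bullet>\<^sub>s x) y) p + (J \<bullet>\<^sub>s J \<bullet>\<^sub>s dorfman E x y) p))"

locale complex_structure = courant_algebroid E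
  for E :: "('m::{second_countable_topology, t2_space}, 'c::real_inner, 'v::real_vector, 'z) courant_scheme" +
  fixes J :: "'m \<Rightarrow> 'v \<Rightarrow> 'v"
  assumes J_fibre: "u \<in> fibre E p \<Longrightarrow> J p u \<in> fibre E p"
    and J_linear: "linear_on (fibre E p) (J p)"
    and J_smooth: "open U \<Longrightarrow> x \<in> sections_on E U \<Longrightarrow> J \<bullet>\<^sub>s x \<in> sections_on E U"
    and J_orthogonal: "u \<in> fibre E p \<Longrightarrow> v \<in> fibre E p \<Longrightarrow> pairing E p (J p u) (J p v) = pairing E p u v"
    and J_square: "u \<in> fibre E p \<Longrightarrow> J p (J p u) = - u"
    and J_integrable: "x \<in> sections E \<Longrightarrow> y \<in> sections E \<Longrightarrow> nijenhuis E J x y = (\<lambda>p. 0)"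

text \<open>The eigenbundles of \<open>J\<close>.\<close>

definition L_of :: "('m, 'c, 'v::real_vector, 'z) courant_scheme \<Rightarrow> ('m \<Rightarrow> 'v \<Rightarrow> 'v) \<Rightarrow> 'm \<Rightarrow> ('v \<times> 'v) set" where
  "L_of E J p = {w \<in> cfibre E p. cextend J p w = \<i> *\<^sub>C w}"

text \<open>
  The conjugate eigenbundle. Via the pairing it is the dual of \<^term>\<open>L_of E J\<close>, and it is used
  below wherever the Lie algebroid \<open>L\<^sub>J\<^sup>*\<close> occurs.
\<close>

definition Lstar_of :: "('m, 'c, 'v::real_vector, 'z) courant_scheme \<Rightarrow> ('m \<Rightarrow> 'v \<Rightarrow> 'v) \<Rightarrow> 'm \<Rightarrow> ('v \<times> 'v) set" where
  "Lstar_of E J p = {w \<in> cfibre E p. cextend J p w = (- \<i>) *\<^sub>C w}"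


section \<open>Holomorphic symplectic structures\<close>

text \<open>The bivector \<open>a \<and> b\<close> at \<open>p\<close>, viewed as a 2-form via \<open>e \<mapsto> \<langle>e, \<cdot>\<rangle>\<close>.\<close>

definition wedge ::
  "('m, 'c, 'v::real_vector, 'z) courant_scheme \<Rightarrow> 'm \<Rightarrow> 'v \<times> 'v \<Rightarrow> 'v \<times> 'v \<Rightarrow> 'v \<times> 'v \<Rightarrow> 'v \<times> 'v \<Rightarrow> complex"
  where
  "wedge E p a b u v = cpairing E p a u * cpairing E p b v - cpairing E p a v * cpairing E p b u"

text \<open>
  Smooth sections of \<open>\<And>\<^sup>2B\<close> for a subbundle \<open>B\<close> of \<open>E \<otimes> \<complex>\<close>: locally, finite sums of wedge products
  of smooth sections of \<open>B\<close>. They are viewed as 2-forms on \<open>E \<otimes> \<complex>\<close>; their values outside the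
  fibres carry no information.
\<close>

definition wedge2_sections ::
  "('m::topological_space, 'c::real_inner, 'v::real_vector, 'z) courant_scheme \<Rightarrow> ('m \<Rightarrow> ('v \<times> 'v) set)
     \<Rightarrow> ('m \<Rightarrow> 'v \<times> 'v \<Rightarrow> 'v \<times> 'v \<Rightarrow> complex) set" where
  "wedge2_sections E B = {\<Omega>. \<forall>p. \<exists>U n a b. open U \<and> p \<in> U \<and>
     (\<forall>k<n. a k \<in> csections_on E B U \<and> b k \<in> csections_on E B U) \<and>
     (\<forall>q\<in>U. \<forall>u\<in>cfibre E q. \<forall>v\<in>cfibre E q. \<Omega> q u v = (\<Sum>k<(n::nat). wedge E q (a k q) (b k q) u v))}"

text \<open>The map \<open>\<Omega>\<^sup>\<sharp>\<close> with \<open>\<Omega>(u, v) = \<langle>\<Omega>\<^sup>\<sharp> u, v\<rangle>\<close>.\<close>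

definition sharp ::
  "('m, 'c, 'v::real_vector, 'z) courant_scheme \<Rightarrow> ('m \<Rightarrow> 'v \<times> 'v \<Rightarrow> 'v \<times> 'v \<Rightarrow> complex)
     \<Rightarrow> 'm \<Rightarrow> 'v \<times> 'v \<Rightarrow> 'v \<times> 'v" where
  "sharp E \<Omega> p u = (THE w. w \<in> cfibre E p \<and> (\<forall>v\<in>cfibre E p. \<Omega> p u v = cpairing E p w v))"

text \<open>The complex conjugate of a 2-form on \<open>E \<otimes> \<complex>\<close>; it maps \<open>a \<and> b\<close> to the wedge product of the
  conjugates of \<open>a\<close> and \<open>b\<close>.\<close>

definition conj_form ::
  "('m \<Rightarrow> 'v::real_vector \<times> 'v \<Rightarrow> 'v \<times> 'v \<Rightarrow> complex) \<Rightarrow> 'm \<Rightarrow> 'v \<times> 'v \<Rightarrow> 'v \<times> 'v \<Rightarrow> complex" where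
  "conj_form \<Omega> p u v = cnj (\<Omega> p (conj_vec u) (conj_vec v))"

text \<open>
  The Lie algebroid differential of a 2-form \<open>\<omega>\<close>, evaluated on sections of a Lie algebroid contained
  in \<open>E \<otimes> \<complex>\<close>.
\<close>

definition d_form2 ::
  "('m, 'c, 'v::real_vector, 'z) courant_scheme \<Rightarrow> ('m \<Rightarrow> 'v \<times> 'v \<Rightarrow> 'v \<times> 'v \<Rightarrow> complex)
     \<Rightarrow> ('m \<Rightarrow> 'v \<times> 'v) \<Rightarrow> ('m \<Rightarrow> 'v \<times> 'v) \<Rightarrow> ('m \<Rightarrow> 'v \<times> 'v) \<Rightarrow> 'm \<Rightarrow> complex" where
  "d_form2 E \<omega> x y z = (\<lambda>p.
       canchor_der E x (\<lambda>q. \<omega> q (y q) (z q)) p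
     - canchor_der E y (\<lambda>q. \<omega> q (x q) (z q)) p
     + canchor_der E z (\<lambda>q. \<omega> q (x q) (y q)) p
     - \<omega> p (cdorfman E x y p) (z p)
     + \<omega> p (cdorfman E x z p) (y p)
     - \<omega> p (cdorfman E y z p) (x p))"

locale holomorphic_symplectic = complex_structure E J
  for E :: "('m::{second_countable_topology, t2_space}, 'c::real_inner, 'v::real_vector, 'z) courant_scheme"
    and J +
  fixes \<Omega> :: "'m \<Rightarrow> 'v \<times> 'v \<Rightarrow> 'v \<times> 'v \<Rightarrow> complex"
  assumes Omega_section: "\<Omega> \<in> wedge2_sections E (L_of E J)"
    and Omega_closed: "x \<in> csections E (Lstar_of E J) \<Longrightarrow> y \<in> csections E (Lstar_of E J) \<Longrightarrow>
      z \<in> csections E (Lstar_of E J) \<Longrightarrow> d_form2 E \<Omega> x y z = (\<lambda>p. 0)"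
    and Omega_sharp: "u \<in> cfibre E p \<Longrightarrow>
      sharp E \<Omega> p (sharp E (conj_form \<Omega>) p u) + sharp E (conj_form \<Omega>) p (sharp E \<Omega> p u) = - u"


section \<open>Lagrangian Lie subalgebroids and connections\<close>

text \<open>
  Complex (smooth, locally trivial) subbundles \<open>L\<close> of \<open>A\<close>, where \<open>A\<close> is itself a subbundle of
  \<open>E \<otimes> \<complex>\<close>.
\<close>

definition csubbundle ::
  "('m::topological_space, 'c::real_inner, 'v::real_vector, 'z) vbundle_scheme \<Rightarrow> ('m \<Rightarrow> ('v \<times> 'v) set)
     \<Rightarrow> ('m \<Rightarrow> ('v \<times> 'v) set) \<Rightarrow> bool" where
  "csubbundle E A L \<longleftrightarrow>
     (\<forall>p. csubspace (L p) \<and> L p \<subseteq> A p) \<and>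
     (\<forall>p. \<exists>U r e. open U \<and> p \<in> U \<and> (\<forall>i<(r::nat). e i \<in> csections_on E L U) \<and>
       (\<forall>q\<in>U. inj_on (\<lambda>i. e i q) {..<r} \<and> \<not> cdependent ((\<lambda>i. e i q) ` {..<r}) \<and>
               cspan ((\<lambda>i. e i q) ` {..<r}) = L q))"

definition lie_subalgebroid ::
  "('m::topological_space, 'c::real_inner, 'v::real_vector, 'z) courant_scheme \<Rightarrow> ('m \<Rightarrow> ('v \<times> 'v) set)
     \<Rightarrow> ('m \<Rightarrow> ('v \<times> 'v) set) \<Rightarrow> bool" where
  "lie_subalgebroid E A L \<longleftrightarrow> csubbundle E A L \<and>
     (\<forall>x\<in>csections E L. \<forall>y\<in>csections E L. cdorfman E x y \<in> csections E L)"

definition isotropic :: "('w \<Rightarrow> 'w \<Rightarrow> complex) \<Rightarrow> 'w set \<Rightarrow> bool" where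
  "isotropic \<omega> W \<longleftrightarrow> (\<forall>u\<in>W. \<forall>v\<in>W. \<omega> u v = 0)"

text \<open>In every fibre, \<open>L\<close> is maximal among the isotropic subspaces of \<open>A\<close>.\<close>

definition lagrangian ::
  "('m \<Rightarrow> 'v::real_vector \<times> 'v \<Rightarrow> 'v \<times> 'v \<Rightarrow> complex) \<Rightarrow> ('m \<Rightarrow> ('v \<times> 'v) set)
     \<Rightarrow> ('m \<Rightarrow> ('v \<times> 'v) set) \<Rightarrow> bool" where
  "lagrangian \<Omega> A L \<longleftrightarrow> (\<forall>p. isotropic (\<Omega> p) (L p) \<and>
     (\<forall>W. csubspace W \<and> L p \<subseteq> W \<and> W \<subseteq> A p \<and> isotropic (\<Omega> p) W \<longrightarrow> W = L p))"

text \<open>\<open>L\<close>-connections on \<open>V\<close>, for subbundles \<open>L\<close> and \<open>V\<close> of \<open>E \<otimes> \<complex>\<close>.\<close>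

definition algebroid_connection ::
  "('m, 'c::real_inner, 'v::real_vector, 'z) courant_scheme \<Rightarrow> ('m \<Rightarrow> ('v \<times> 'v) set)
     \<Rightarrow> ('m \<Rightarrow> ('v \<times> 'v) set) \<Rightarrow> (('m \<Rightarrow> 'v \<times> 'v) \<Rightarrow> ('m \<Rightarrow> 'v \<times> 'v) \<Rightarrow> ('m \<Rightarrow> 'v \<times> 'v)) \<Rightarrow> bool" where
  "algebroid_connection E L V D \<longleftrightarrow>
     (\<forall>x\<in>csections E L. \<forall>v\<in>csections E V. D x v \<in> csections E V) \<and>
     (\<forall>x\<in>csections E L. \<forall>y\<in>csections E L. \<forall>v\<in>csections E V.
        D (\<lambda>p. x p + y p) v = (\<lambda>p. D x v p + D y v p)) \<and>
     (\<forall>x\<in>csections E L. \<forall>v\<in>csections E V. \<forall>w\<in>csections E V.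
        D x (\<lambda>p. v p + w p) = (\<lambda>p. D x v p + D x w p)) \<and>
     (\<forall>a. \<forall>x\<in>csections E L. \<forall>v\<in>csections E V.
        D (\<lambda>p. a *\<^sub>C x p) v = (\<lambda>p. a *\<^sub>C D x v p) \<and> D x (\<lambda>p. a *\<^sub>C v p) = (\<lambda>p. a *\<^sub>C D x v p)) \<and>
     (\<forall>f\<in>smooth_funs E. \<forall>x\<in>csections E L. \<forall>v\<in>csections E V.
        D (\<lambda>p. f p *\<^sub>C x p) v = (\<lambda>p. f p *\<^sub>C D x v p)) \<and>
     (\<forall>f\<in>smooth_funs E. \<forall>x\<in>csections E L. \<forall>v\<in>csections E V.
        D x (\<lambda>p. f p *\<^sub>C v p) = (\<lambda>p. f p *\<^sub>C D x v p + canchor_der E x f p *\<^sub>C v p))"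

definition torsion_free ::
  "('m, 'c::real_inner, 'v::real_vector, 'z) courant_scheme \<Rightarrow> ('m \<Rightarrow> ('v \<times> 'v) set)
     \<Rightarrow> (('m \<Rightarrow> 'v \<times> 'v) \<Rightarrow> ('m \<Rightarrow> 'v \<times> 'v) \<Rightarrow> ('m \<Rightarrow> 'v \<times> 'v)) \<Rightarrow> bool" where
  "torsion_free E L D \<longleftrightarrow>
     (\<forall>x\<in>csections E L. \<forall>y\<in>csections E L. (\<lambda>p. D x y p - D y x p) = cdorfman E x y)"

definition flat ::
  "('m, 'c::real_inner, 'v::real_vector, 'z) courant_scheme \<Rightarrow> ('m \<Rightarrow> ('v \<times> 'v) set)
     \<Rightarrow> (('m \<Rightarrow> 'v \<times> 'v) \<Rightarrow> ('m \<Rightarrow> 'v \<times> 'v) \<Rightarrow> ('m \<Rightarrow> 'v \<times> 'v)) \<Rightarrow> bool" where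
  "flat E L D \<longleftrightarrow>
     (\<forall>x\<in>csections E L. \<forall>y\<in>csections E L. \<forall>z\<in>csections E L.
        (\<lambda>p. D x (D y z) p - D y (D x z) p - D (cdorfman E x y) z p) = (\<lambda>p. 0))"

text \<open>
  The hypercomplex connection on sections of \<open>E \<otimes> \<complex>\<close>. Here \<open>I\<close>, \<open>J\<close>, \<open>K\<close> are complex linear
  endomorphisms of \<open>E \<otimes> \<complex>\<close>, so the formula is the \<open>\<complex>\<close>-bilinear extension.
\<close>

definition hypercomplex_connection ::
  "('m, 'c, 'v::real_vector, 'z) courant_scheme \<Rightarrow> ('m \<Rightarrow> 'v \<times> 'v \<Rightarrow> 'v \<times> 'v) \<Rightarrow> ('m \<Rightarrow> 'v \<times> 'v \<Rightarrow> 'v \<times> 'v)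
     \<Rightarrow> ('m \<Rightarrow> 'v \<times> 'v \<Rightarrow> 'v \<times> 'v) \<Rightarrow> ('m \<Rightarrow> 'v \<times> 'v) \<Rightarrow> ('m \<Rightarrow> 'v \<times> 'v) \<Rightarrow> ('m \<Rightarrow> 'v \<times> 'v)" where
  "hypercomplex_connection E I J K U V = (\<lambda>p. - (1/2) *\<^sub>R K p
     (cdorfman E (J \<bullet>\<^sub>s V) (I \<bullet>\<^sub>s U) p - (J \<bullet>\<^sub>s cdorfman E V (I \<bullet>\<^sub>s U)) p
        - (I \<bullet>\<^sub>s cdorfman E (J \<bullet>\<^sub>s V) U) p + (J \<bullet>\<^sub>s I \<bullet>\<^sub>s cdorfman E V U) p))"

end

theory Submission
  imports Defs
begin

text \<open>
  Write \<open>A = \<Omega>\<^sup>\<sharp>\<close> and \<open>B\<close> for its complex conjugate. As \<open>\<Omega>\<close> is a section of \<open>\<And>\<^sup>2L\<^sub>J\<close> and the eigenbundles of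
  \<open>J\<close> are isotropic, \<open>A\<close> vanishes on \<open>L\<^sub>J\<close> and maps \<open>L\<^sub>J\<^sup>*\<close> into \<open>L\<^sub>J\<close>, while \<open>B\<close> does the opposite; the
  relation \<open>AB + BA = -1\<close> then says that \<open>A : L\<^sub>J\<^sup>* \<rightarrow> L\<^sub>J\<close> is an isomorphism with inverse \<open>-B\<close>. For sections
  \<open>U, V\<close> of \<open>L\<^sub>J\<^sup>*\<close>, which are closed under the Dorfman bracket because \<open>J\<close> is integrable, the formula for
  the hypercomplex connection collapses to
  \<open>\<nabla>\<^sub>U V = - B (V \<circ> A U) - V \<circ> U\<close> (\<open>hypercomplex_connection_Lstar\<close>).

  If moreover \<open>\<Omega>(U, V) = 0\<close>, then \<open>d\<Omega> = 0\<close>, evaluated on \<open>U\<close>, \<open>V\<close> and an arbitrary third section, turns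
  this into \<open>\<nabla>\<^sub>U V = - B (U \<circ> A V)\<close> (\<open>sharp_connection_symmetric\<close>). This second expression has a meaning:
  \<open>L\<^sub>J\<^sup>*\<close> acts on \<open>(E \<otimes> \<complex>) / L\<^sub>J\<^sup>* \<cong> L\<^sub>J\<close> by the bracket, and \<open>\<nabla>\<close> is this action, carried over to \<open>L\<^sub>J\<^sup>*\<close>
  by the isomorphism \<open>A\<close>. On a Lagrangian subalgebroid \<open>L\<close> everything follows from the two expressions:

  \<^item> comparing them shows that \<open>\<nabla>\<close> is torsion-free (\<open>nabla_torsion\<close>);

  \<^item> the second one gives the Leibniz rule, and the Jacobi identity makes it flat (\<open>nabla_flat\<close>);

  \<^item> linearity over functions in the first argument follows from the Leibniz rule by exchanging the
    arguments with the torsion identity (\<open>nabla_tensorial\<close>);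

  \<^item> for a section \<open>W\<close> of \<open>L\<close>, \<open>\<Omega>(\<nabla>\<^sub>U V, W) = \<langle>U \<circ> A V, W\<rangle> = \<rho>(U)\<Omega>(V, W) - \<Omega>(V, U \<circ> W) = 0\<close>, and a maximal
    isotropic subspace is its own orthogonal space, so \<open>\<nabla>\<^sub>U V\<close> is again a section of \<open>L\<close>
    (\<open>nabla_closed\<close>).

  The equation \<open>d\<Omega> = 0\<close> speaks about global sections, but it has to be used with an arbitrary vector
  \<open>W p\<close> in a fibre. So every vector must extend to a global section, which needs smooth bump functions;
  they come from the function \<open>exp (- 1 / t)\<close>. The rest of the analysis shows that smooth sections
  form a sheaf of modules, which makes \<open>A\<close> and \<open>B\<close>, given by local formulas, act on global
  sections.
\<close>

section \<open>Differentiable functions\<close>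

lemma ck_on_cong:
  assumes "open S" "\<And>x. x \<in> S \<Longrightarrow> f x = g x" "ck_on k S f"
  shows "ck_on k S g"
  using assms(2,3)
proof (induction k arbitrary: f g)
  case 0
  then show ?case using continuous_on_cong[of S S f g] by simp
next
  case (Suc k)
  have d: "(g has_derivative frechet_derivative f (at x)) (at x)" if "x \<in> S" for x
    using Suc.prems has_derivative_transform_within_open[OF _ assms(1) that, of f _ UNIV g] that
    by (auto simp: frechet_derivative_works)
  have "ck_on k S (\<lambda>x. frechet_derivative g (at x) v)" for v
    by (rule Suc.IH[of "\<lambda>x. frechet_derivative f (at x) v"])
      (use Suc.prems in \<open>auto simp: frechet_derivative_at[OF d]\<close>)
  then show ?case using d by (auto simp: differentiable_def)
qed

text \<open>
  The recursion defining \<open>ck_on\<close> mentions \<^const>\<open>frechet_derivative\<close>, which is a choice operator; this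
  rule lets any explicitly known derivative be used instead.
\<close>

lemma ck_on_SucI:
  assumes "open S" "\<And>x. x \<in> S \<Longrightarrow> (f has_derivative f' x) (at x)" "\<And>v. ck_on k S (\<lambda>x. f' x v)"
  shows "ck_on (Suc k) S f"
proof -
  have "ck_on k S (\<lambda>x. frechet_derivative f (at x) v)" for v
    by (rule ck_on_cong[OF assms(1) _ assms(3)[of v]]) (simp add: frechet_derivative_at[OF assms(2)])
  then show ?thesis using assms(2) by (auto simp: differentiable_def)
qed

lemma ck_on_subset: "ck_on k S f \<Longrightarrow> T \<subseteq> S \<Longrightarrow> ck_on k T f"
  by (induction k arbitrary: f) (auto intro: continuous_on_subset)

lemma ck_on_has_derivative:
  "ck_on (Suc k) S f \<Longrightarrow> x \<in> S \<Longrightarrow> (f has_derivative frechet_derivative f (at x)) (at x)"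
  by (simp add: frechet_derivative_works)

lemma ck_on_SucD: "ck_on (Suc k) S f \<Longrightarrow> ck_on k S f"
proof (induction k arbitrary: f)
  case 0
  then show ?case
    by (auto intro!: continuous_at_imp_continuous_on differentiable_imp_continuous_within)
qed simp

lemma ck_on_local:
  assumes "\<And>x. x \<in> S \<Longrightarrow> \<exists>T. open T \<and> x \<in> T \<and> ck_on k T f"
  shows "ck_on k S f"
  using assms
proof (induction k arbitrary: f)
  case 0
  then show ?case
    by (simp, intro continuous_at_imp_continuous_on ballI) (metis continuous_on_eq_continuous_at)
next
  case (Suc k)
  have "ck_on k S (\<lambda>x. frechet_derivative f (at x) v)" for v
  proof (rule Suc.IH)
    fix x assume "x \<in> S"
    from Suc.prems[OF this] show "\<exists>T. open T \<and> x \<in> T \<and> ck_on k T (\<lambda>x. frechet_derivative f (at x) v)"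
      by auto
  qed
  moreover have "f differentiable (at x)" if "x \<in> S" for x
    using Suc.prems[OF that] by auto
  ultimately show ?case by simp
qed

lemma ck_on_const: "ck_on k S (\<lambda>x. c)"
  by (induction k arbitrary: c) (auto simp: frechet_derivative_const)

lemma ck_on_bounded_linear:
  assumes "open S" "bounded_linear h" "ck_on k S f"
  shows "ck_on k S (\<lambda>x. h (f x))"
  using assms(3)
proof (induction k arbitrary: f)
  case 0
  then show ?case using assms(2) by (simp add: bounded_linear.continuous_on)
next
  case (Suc k)
  show ?case
    by (rule ck_on_SucI[OF assms(1) bounded_linear.has_derivative[OF assms(2) ck_on_has_derivative[OF Suc.prems]]])
      (use Suc in auto)
qed

lemma ck_on_add:
  assumes "open S" "ck_on k S f" "ck_on k S g"
  shows "ck_on k S (\<lambda>x. f x + g x)"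
  using assms(2,3)
proof (induction k arbitrary: f g)
  case 0
  then show ?case by (simp add: continuous_on_add)
next
  case (Suc k)
  show ?case
    by (rule ck_on_SucI[OF assms(1) has_derivative_add[OF Suc.prems[THEN ck_on_has_derivative]]])
      (use Suc in auto)
qed

lemma ck_on_bilinear:
  assumes "open S" "bounded_bilinear h" "ck_on k S f" "ck_on k S g"
  shows "ck_on k S (\<lambda>x. h (f x) (g x))"
  using assms(3,4)
proof (induction k arbitrary: f g)
  case 0
  then show ?case using bounded_bilinear.continuous_on[OF assms(2)] by simp
next
  case (Suc k)
  show ?case
    by (rule ck_on_SucI[OF assms(1) bounded_bilinear.FDERIV[OF assms(2) Suc.prems[THEN ck_on_has_derivative]]])
      (use Suc Suc.prems[THEN ck_on_SucD] in \<open>auto intro!: ck_on_add assms(1)\<close>)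
qed

section \<open>The flat exponential function and compact balls\<close>

definition flat_exp :: "real poly \<Rightarrow> real \<Rightarrow> real" where
  "flat_exp q t = (if t \<le> 0 then 0 else poly q (1 / t) * exp (- (1 / t)))"

lemma poly_exp_tendsto_0: "((\<lambda>x::real. poly q x * exp (- x)) \<longlongrightarrow> 0) at_top"
proof (induction q)
  case (pCons a q)
  have *: "((\<lambda>x::real. poly q x * (x ^ k / exp x)) \<longlongrightarrow> 0) at_top" for k
  proof (induction q arbitrary: k)
    case (pCons a q)
    have "((\<lambda>x::real. a * (x ^ k / exp x) + poly q x * (x ^ Suc k / exp x)) \<longlongrightarrow> a * 0 + 0) at_top"
      by (intro tendsto_add tendsto_mult tendsto_const tendsto_power_div_exp_0 pCons.IH)
    then show ?case by (simp add: algebra_simps)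
  qed simp
  have "((\<lambda>x::real. a * (x ^ 0 / exp x) + poly q x * (x ^ 1 / exp x)) \<longlongrightarrow> a * 0 + 0) at_top"
    by (intro tendsto_add tendsto_mult tendsto_const tendsto_power_div_exp_0 *)
  then show ?case by (simp add: algebra_simps exp_minus field_simps)
qed simp

text \<open>
  The polynomial factor is what closes this family of functions under differentiation: since
  \<open>(1 / t)' = - (1 / t)\<^sup>2\<close>, the derivative of \<open>q (1 / t) exp (- 1 / t)\<close> is the function of the same
  shape for the polynomial \<open>X\<^sup>2 (q - q')\<close>. At \<open>0\<close> the difference quotient tends to \<open>0\<close> because the
  exponential beats every polynomial.
\<close>

lemma flat_exp_derivative:
  "(flat_exp q has_real_derivative flat_exp ([:0, 0, 1:] * (q - pderiv q)) t) (at t)"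
proof -
  consider "t < 0" | "t > 0" | "t = 0" by linarith
  then show ?thesis
  proof cases
    case 1
    have "((\<lambda>x. 0) has_real_derivative 0) (at t)" by simp
    then have "(flat_exp q has_real_derivative 0) (at t)"
      by (rule DERIV_cong_ev[THEN iffD1, rotated -1, OF _ refl _ refl])
        (use 1 in \<open>auto simp: flat_exp_def eventually_nhds intro!: exI[of _ "{..<0}"]\<close>)
    then show ?thesis using 1 by (simp add: flat_exp_def)
  next
    case 2
    have "((\<lambda>t. poly q (1 / t) * exp (- (1 / t))) has_real_derivative
            poly ([:0, 0, 1:] * (q - pderiv q)) (1 / t) * exp (- (1 / t))) (at t)"
    proof -
      have i: "((\<lambda>t. 1 / t) has_real_derivative - (1 / t * (1 / t))) (at t)"
        using DERIV_inverse[of t UNIV] 2 by (simp add: inverse_eq_divide power2_eq_square)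
      show ?thesis
        using DERIV_mult[OF DERIV_chain2[OF poly_DERIV i] DERIV_chain2[OF DERIV_exp DERIV_minus[OF i]]]
        by (simp add: algebra_simps)
    qed
    then have "(flat_exp q has_real_derivative poly ([:0, 0, 1:] * (q - pderiv q)) (1 / t) * exp (- (1 / t))) (at t)"
      by (rule DERIV_cong_ev[THEN iffD1, rotated -1, OF _ refl _ refl])
        (use 2 in \<open>auto simp: flat_exp_def eventually_nhds intro!: exI[of _ "{0<..}"]\<close>)
    then show ?thesis using 2 by (simp add: flat_exp_def)
  next
    case 3
    have "((\<lambda>h. flat_exp q h / h) \<longlongrightarrow> 0) (at_right 0)"
    proof -
      have "((\<lambda>h. poly ([:0, 1:] * q) (inverse h) * exp (- inverse h)) \<longlongrightarrow> 0) (at_right (0::real))"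
        by (rule filterlim_compose[OF poly_exp_tendsto_0 filterlim_inverse_at_top_right])
      then show ?thesis
        by (rule tendsto_cong[THEN iffD1, rotated])
          (auto simp: eventually_at_filter flat_exp_def field_simps)
    qed
    moreover have "((\<lambda>h. flat_exp q h / h) \<longlongrightarrow> 0) (at_left 0)"
      by (rule tendsto_eventually) (auto simp: eventually_at_filter flat_exp_def)
    ultimately have "((\<lambda>h. flat_exp q h / h) \<longlongrightarrow> 0) (at 0)"
      by (simp add: filterlim_split_at)
    then show ?thesis using 3 by (simp add: DERIV_def flat_exp_def)
  qed
qed

lemma ck_on_flat_exp:
  assumes "open S" "ck_on k S u"
  shows "ck_on k S (\<lambda>x. flat_exp q (u x))"
  using assms(2)
proof (induction k arbitrary: q)
  case 0
  have "continuous_on UNIV (flat_exp q)"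
    using flat_exp_derivative by (auto intro!: DERIV_continuous_on)
  with 0 show ?case by (auto intro: continuous_on_compose2)
next
  case (Suc k)
  have d: "((\<lambda>x. flat_exp q (u x)) has_derivative
      (\<lambda>v. frechet_derivative u (at x) v * flat_exp ([:0, 0, 1:] * (q - pderiv q)) (u x))) (at x)" if "x \<in> S" for x
    using has_derivative_compose[OF ck_on_has_derivative[OF Suc.prems that]
        flat_exp_derivative[unfolded has_field_derivative_def]]
    by (simp only: mult.commute)
  show ?case
    by (rule ck_on_SucI[OF assms(1) d], assumption, rule ck_on_bilinear[OF assms(1) bounded_bilinear_mult _ Suc.IH])
      (use Suc.prems[THEN ck_on_SucD] Suc.prems in auto)
qed

text \<open>
  In orthogonal coordinates, the Cauchy-Schwarz inequality puts the ball into a box, and a box is a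
  finite sum of compact segments.
\<close>

lemma compact_cball_finite_span:
  assumes "finite B" "span B = (UNIV :: 'a::real_inner set)"
  shows "compact (cball (x::'a) r)"
proof -
  obtain C :: "'a set" where C: "finite C" "span C = UNIV" "pairwise orthogonal C"
    using basis_orthogonal[OF assms(1)] assms(2) by auto
  have expand: "y = (\<Sum>c\<in>C. (y \<bullet> c / (c \<bullet> c)) *\<^sub>R c)" for y
  proof -
    have "y \<in> span C" using C by simp
    then obtain u where u: "y = (\<Sum>c\<in>C. u c *\<^sub>R c)" using C(1) by (auto simp: span_finite)
    have "y \<bullet> c = u c * (c \<bullet> c)" if "c \<in> C" for c
    proof -
      have "y \<bullet> c = (\<Sum>d\<in>C. u d * (d \<bullet> c))" by (simp add: u inner_sum_left)
      also have "\<dots> = (\<Sum>d\<in>C. if d = c then u c * (c \<bullet> c) else 0)"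
        using C(3) that by (intro sum.cong refl) (auto simp: pairwise_def orthogonal_def)
      finally show ?thesis using C(1) that by simp
    qed
    then have "(\<Sum>c\<in>C. (y \<bullet> c / (c \<bullet> c)) *\<^sub>R c) = (\<Sum>c\<in>C. u c *\<^sub>R c)"
      by (intro sum.cong refl) auto
    then show ?thesis using u by simp
  qed
  have box: "compact {(\<Sum>c\<in>C. u c *\<^sub>R c) | u. \<forall>c\<in>C. \<bar>u c\<bar> \<le> (b c :: real)}" for b
    using C(1)
  proof (induction C)
    case (insert d C)
    have "{(\<Sum>c\<in>insert d C. u c *\<^sub>R c) | u. \<forall>c\<in>insert d C. \<bar>u c\<bar> \<le> b c}
      = {x + y | x y. x \<in> (\<lambda>t. t *\<^sub>R d) ` {- b d..b d} \<and> y \<in> {(\<Sum>c\<in>C. u c *\<^sub>R c) | u. \<forall>c\<in>C. \<bar>u c\<bar> \<le> b c}}"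
      (is "?L = ?R")
    proof
      show "?L \<subseteq> ?R"
      proof
        fix z assume "z \<in> ?L"
        then obtain u where u: "z = (\<Sum>c\<in>insert d C. u c *\<^sub>R c)" "\<forall>c\<in>insert d C. \<bar>u c\<bar> \<le> b c"
          by blast
        then have "z = u d *\<^sub>R d + (\<Sum>c\<in>C. u c *\<^sub>R c)" "u d \<in> {- b d..b d}" "\<forall>c\<in>C. \<bar>u c\<bar> \<le> b c"
          using insert.hyps by auto
        then show "z \<in> ?R" by blast
      qed
      show "?R \<subseteq> ?L"
      proof
        fix z assume "z \<in> ?R"
        then obtain t u where z: "z = t *\<^sub>R d + (\<Sum>c\<in>C. u c *\<^sub>R c)" "\<bar>t\<bar> \<le> b d" "\<forall>c\<in>C. \<bar>u c\<bar> \<le> b c"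
          by auto
        have "(\<Sum>c\<in>C. (u(d := t)) c *\<^sub>R c) = (\<Sum>c\<in>C. u c *\<^sub>R c)"
          using insert.hyps by (intro sum.cong refl) auto
        then show "z \<in> ?L" using z insert.hyps by (intro CollectI exI[of _ "u(d := t)"]) auto
      qed
    qed
    moreover have "compact ((\<lambda>t. t *\<^sub>R d) ` {- b d..b d})"
      by (intro compact_continuous_image continuous_intros) auto
    ultimately show ?case using compact_sums[OF _ insert.IH] by simp
  qed simp
  have "cball (0::'a) r \<subseteq> {(\<Sum>c\<in>C. u c *\<^sub>R c) | u. \<forall>c\<in>C. \<bar>u c\<bar> \<le> r * norm c / (c \<bullet> c)}"
  proof
    fix y assume "y \<in> cball (0::'a) r"
    then have "\<bar>y \<bullet> c\<bar> \<le> r * norm c" for c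
      by (metis Cauchy_Schwarz_ineq2 dist_0_norm mem_cball mult_right_mono norm_ge_zero order_trans)
    then have "\<forall>c\<in>C. \<bar>y \<bullet> c / (c \<bullet> c)\<bar> \<le> r * norm c / (c \<bullet> c)"
      by (simp add: abs_divide divide_right_mono)
    with expand[of y] show "y \<in> {(\<Sum>c\<in>C. u c *\<^sub>R c) | u. \<forall>c\<in>C. \<bar>u c\<bar> \<le> r * norm c / (c \<bullet> c)}"
      by (intro CollectI exI[of _ "\<lambda>c. y \<bullet> c / (c \<bullet> c)"]) simp
  qed
  then have "compact (cball (0::'a) r)"
    using compact_Int_closed[OF box[of "\<lambda>c. r * norm c / (c \<bullet> c)"] closed_cball[of 0 r]]
    by (simp add: Int_absorb1)
  then have "compact ((+) x ` cball 0 r)" by (rule compact_translation)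
  then show ?thesis by simp
qed

section \<open>Smooth functions on a manifold\<close>

context smooth_manifold
begin

lemma open_chart_image:
  assumes "(V, \<phi>) \<in> charts M" "open U"
  shows "open (\<phi> ` (U \<inter> V))"
proof -
  obtain \<psi> where V: "open V" "open (\<phi> ` V)" "homeomorphism V (\<phi> ` V) \<phi> \<psi>"
    using charts[OF assms(1)] by (auto simp: is_chart_def)
  have "openin (top_of_set V) (U \<inter> V)" using assms(2) by (auto simp: openin_open)
  then have "openin (top_of_set (\<phi> ` V)) (\<phi> ` (U \<inter> V))"
    by (rule homeomorphism_imp_open_map[OF V(3)])
  then show ?thesis using V(2) openin_open_trans by blast
qed

lemma chart_inv_into:
  assumes "(V, \<phi>) \<in> charts M" "p \<in> V"
  shows "inv_into V \<phi> (\<phi> p) = p"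
proof -
  have "inj_on \<phi> V"
    using charts[OF assms(1)] by (auto simp: is_chart_def homeomorphism_def intro: inj_on_inverseI)
  then show ?thesis using assms(2) by simp
qed

lemma smooth_fun_on_iff:
  "smooth_fun_on M U f \<longleftrightarrow>
    (\<forall>V \<phi> k. (V, \<phi>) \<in> charts M \<longrightarrow> ck_on k (\<phi> ` (U \<inter> V)) (\<lambda>x. f (inv_into V \<phi> x)))"
  by (auto simp: smooth_fun_on_def smooth_on_def o_def)

lemma smooth_fun_on_cong:
  assumes "open U" "\<And>p. p \<in> U \<Longrightarrow> f p = g p" "smooth_fun_on M U f"
  shows "smooth_fun_on M U g"
  unfolding smooth_fun_on_iff
proof (intro allI impI)
  fix V \<phi> k assume V: "(V, \<phi>) \<in> charts M"
  show "ck_on k (\<phi> ` (U \<inter> V)) (\<lambda>x. g (inv_into V \<phi> x))"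
    by (rule ck_on_cong[OF open_chart_image[OF V assms(1)], of "\<lambda>x. f (inv_into V \<phi> x)"])
      (use assms(2,3) V in \<open>auto simp: smooth_fun_on_iff chart_inv_into\<close>)
qed

lemma smooth_fun_on_subset: "smooth_fun_on M U f \<Longrightarrow> W \<subseteq> U \<Longrightarrow> smooth_fun_on M W f"
  unfolding smooth_fun_on_iff by (meson Int_mono ck_on_subset image_mono order_refl)

lemma smooth_fun_on_local:
  assumes "\<And>p. p \<in> U \<Longrightarrow> \<exists>W. open W \<and> p \<in> W \<and> smooth_fun_on M W f"
  shows "smooth_fun_on M U f"
  unfolding smooth_fun_on_iff
proof (intro allI impI, rule ck_on_local)
  fix V \<phi> k x assume V: "(V, \<phi>) \<in> charts M" and "x \<in> \<phi> ` (U \<inter> V)"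
  then obtain p where p: "p \<in> U" "p \<in> V" "x = \<phi> p" by auto
  from assms[OF p(1)] obtain W where "open W" "p \<in> W" "smooth_fun_on M W f" by auto
  then show "\<exists>T. open T \<and> x \<in> T \<and> ck_on k T (\<lambda>x. f (inv_into V \<phi> x))"
    using p V by (intro exI[of _ "\<phi> ` (W \<inter> V)"]) (auto simp: smooth_fun_on_iff open_chart_image)
qed

lemma smooth_fun_on_const: "smooth_fun_on M U (\<lambda>p. c)"
  by (simp add: smooth_fun_on_iff ck_on_const)

lemma smooth_fun_on_add:
  "open U \<Longrightarrow> smooth_fun_on M U f \<Longrightarrow> smooth_fun_on M U g \<Longrightarrow> smooth_fun_on M U (\<lambda>p. f p + g p)"
  unfolding smooth_fun_on_iff by (intro allI impI ck_on_add open_chart_image) auto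

lemma smooth_fun_on_bounded_linear:
  "open U \<Longrightarrow> bounded_linear h \<Longrightarrow> smooth_fun_on M U f \<Longrightarrow> smooth_fun_on M U (\<lambda>p. h (f p))"
  unfolding smooth_fun_on_iff by (intro allI impI, rule ck_on_bounded_linear) (auto simp: open_chart_image)

lemma smooth_fun_on_mult:
  fixes f g :: "'m \<Rightarrow> 'b::real_normed_algebra"
  shows "open U \<Longrightarrow> smooth_fun_on M U f \<Longrightarrow> smooth_fun_on M U g \<Longrightarrow> smooth_fun_on M U (\<lambda>p. f p * g p)"
  unfolding smooth_fun_on_iff
  by (intro allI impI ck_on_bilinear[OF _ bounded_bilinear_mult] open_chart_image) auto

lemma smooth_fun_on_diff:
  fixes f g :: "'m \<Rightarrow> real"
  shows "open U \<Longrightarrow> smooth_fun_on M U f \<Longrightarrow> smooth_fun_on M U g \<Longrightarrow> smooth_fun_on M U (\<lambda>p. f p - g p)"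
  using smooth_fun_on_add[OF _ _ smooth_fun_on_bounded_linear[OF _ bounded_linear_minus[OF bounded_linear_ident]], of U f g]
  by simp

text \<open>
  In a chart around \<open>p\<close>, take the flat exponential of \<open>r\<^sup>2 - \<parallel>y - \<phi> p\<parallel>\<^sup>2\<close>, which is supported in a small
  ball, and extend it by zero. The extension is smooth because the ball is compact, hence its preimage
  is compact, and closed in the Hausdorff space \<open>M\<close>: every point has a neighbourhood inside the chart or one
  outside this preimage.
\<close>

lemma bump_function:
  assumes "open U" "p \<in> U"
  obtains \<eta> :: "'m \<Rightarrow> real" and C where "\<eta> \<in> smooth_funs M" "\<eta> p = 1" "closed C" "C \<subseteq> U"
    "\<And>q. q \<notin> C \<Longrightarrow> \<eta> q = 0"
proof -
  from charts_cover have "p \<in> (\<Union>(U, \<phi>)\<in>charts M. U)" by simp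
  then obtain V \<phi> where V: "(V, \<phi>) \<in> charts M" "p \<in> V" by auto
  obtain \<psi> where hom: "homeomorphism V (\<phi> ` V) \<phi> \<psi>" and "open V"
    using charts[OF V(1)] by (auto simp: is_chart_def)
  have \<psi>\<phi>: "\<psi> (\<phi> q) = q" if "q \<in> V" for q using hom that by (auto simp: homeomorphism_def)
  obtain r where r: "r > 0" "cball (\<phi> p) r \<subseteq> \<phi> ` (U \<inter> V)"
    using open_chart_image[OF V(1) assms(1), unfolded open_contains_cball] assms(2) V(2) by blast
  define C where "C = \<psi> ` cball (\<phi> p) r"
  have "compact (cball (\<phi> p) r)"
    using finite_dim compact_cball_finite_span by blast
  moreover have "continuous_on (cball (\<phi> p) r) \<psi>"
    using hom r(2) by (auto simp: homeomorphism_def intro: continuous_on_subset)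
  ultimately have "closed C"
    unfolding C_def by (intro compact_imp_closed compact_continuous_image)
  have "q \<in> U \<and> q \<in> V \<and> \<phi> q \<in> cball (\<phi> p) r" if "q \<in> C" for q
  proof -
    obtain y where "y \<in> cball (\<phi> p) r" "q = \<psi> y" using \<open>q \<in> C\<close> C_def by blast
    moreover from this obtain q' where "q' \<in> U" "q' \<in> V" "y = \<phi> q'" using r(2) by blast
    ultimately show ?thesis using \<psi>\<phi> by simp
  qed
  moreover have "q \<in> C" if "q \<in> V" "\<phi> q \<in> cball (\<phi> p) r" for q
    using that \<psi>\<phi>[of q] unfolding C_def by (metis image_eqI)
  ultimately have C: "q \<in> C \<longleftrightarrow> q \<in> V \<and> \<phi> q \<in> cball (\<phi> p) r" and "C \<subseteq> U" for q
    by blast+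
  \<comment> \<open>the constant polynomial normalises the value at the centre to 1\<close>
  define g where "g y = flat_exp [:exp (1 / r\<^sup>2):] (r\<^sup>2 - (y - \<phi> p) \<bullet> (y - \<phi> p))" for y
  define \<eta> where "\<eta> q = (if q \<in> V then g (\<phi> q) else 0)" for q
  have 0: "\<eta> q = 0" if "q \<notin> C" for q
  proof (cases "q \<in> V")
    case True
    then have "r < norm (\<phi> q - \<phi> p)" using that C by (simp add: dist_norm norm_minus_commute)
    then have "r\<^sup>2 \<le> (\<phi> q - \<phi> p) \<bullet> (\<phi> q - \<phi> p)"
      using r(1) by (simp add: dot_square_norm power_mono)
    then show ?thesis by (simp add: \<eta>_def g_def flat_exp_def)
  qed (simp add: \<eta>_def)
  have "smooth_fun_on M UNIV \<eta>"
  proof (rule smooth_fun_on_local)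
    fix q
    have "smooth_fun_on M (- C) \<eta>"
      by (rule smooth_fun_on_cong[OF _ _ smooth_fun_on_const[of _ 0]]) (use 0 \<open>closed C\<close> in auto)
    moreover have "smooth_fun_on M V \<eta>"
      unfolding smooth_fun_on_iff
    proof (intro allI impI)
      fix W \<theta> k assume W: "(W, \<theta>) \<in> charts M"
      have op: "open (\<theta> ` (V \<inter> W))" by (rule open_chart_image[OF W \<open>open V\<close>])
      have "ck_on k (\<theta> ` (V \<inter> W)) (\<lambda>x. \<phi> (inv_into W \<theta> x))"
        using charts_compatible[OF W V(1)] by (simp add: smooth_on_def o_def Int_commute)
      from ck_on_add[OF op this ck_on_const[of k _ "- \<phi> p"]]
      have d: "ck_on k (\<theta> ` (V \<inter> W)) (\<lambda>x. \<phi> (inv_into W \<theta> x) - \<phi> p)"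
        by simp
      have "ck_on k (\<theta> ` (V \<inter> W)) (\<lambda>x. r\<^sup>2 + - ((\<phi> (inv_into W \<theta> x) - \<phi> p) \<bullet> (\<phi> (inv_into W \<theta> x) - \<phi> p)))"
        by (intro ck_on_add op ck_on_const ck_on_bounded_linear[OF op bounded_linear_minus[OF bounded_linear_ident]]
            ck_on_bilinear[OF op bounded_bilinear_inner] d)
      then have "ck_on k (\<theta> ` (V \<inter> W)) (\<lambda>x. g (\<phi> (inv_into W \<theta> x)))"
        unfolding g_def by (intro ck_on_flat_exp op) simp
      then show "ck_on k (\<theta> ` (V \<inter> W)) (\<lambda>x. \<eta> (inv_into W \<theta> x))"
        by (rule ck_on_cong[OF op, rotated]) (use W in \<open>auto simp: \<eta>_def chart_inv_into\<close>)
    qed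
    ultimately show "\<exists>T. open T \<and> q \<in> T \<and> smooth_fun_on M T \<eta>"
      using \<open>closed C\<close> \<open>open V\<close> C[of q] by (cases "q \<in> V") (auto simp: open_Compl intro: exI[of _ V] exI[of _ "- C"])
  qed
  moreover have "\<eta> p = 1"
    using r(1) V(2) by (simp add: \<eta>_def g_def flat_exp_def flip: exp_add)
  ultimately show ?thesis
    using that[of \<eta> C] 0 \<open>closed C\<close> \<open>C \<subseteq> U\<close> by (simp add: smooth_funs_def)
qed

end

section \<open>Sections of a vector bundle\<close>

context vector_bundle
begin

text \<open>
  This is what allows coefficient functions found on small open sets to be glued.
\<close>

lemma frame_coefficients_unique:
  assumes "(V, r, e) \<in> frames E" "p \<in> V"
    "(\<Sum>i<r. c i *\<^sub>R e i p) = (\<Sum>i<r. d i *\<^sub>R e i p)" "i < r"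
  shows "c i = d i"
proof -
  note b = frames_basis[OF assms(1,2)]
  let ?B = "(\<lambda>i. e i p) ` {..<r}"
  define u where "u v = (let i = inv_into {..<r} (\<lambda>i. e i p) v in c i - d i)" for v
  have u: "u (e j p) = c j - d j" if "j < r" for j
    using b that by (simp add: u_def Let_def inv_into_f_f[where f = "\<lambda>i. e i p"])
  have "(\<Sum>v\<in>?B. u v *\<^sub>R v) = (\<Sum>j<r. u (e j p) *\<^sub>R e j p)"
    using b by (simp add: sum.reindex)
  also have "\<dots> = (\<Sum>j<r. (c j - d j) *\<^sub>R e j p)" using u by simp
  also have "\<dots> = 0" using assms(3) by (simp add: scaleR_left_diff_distrib sum_subtractf)
  finally have "u (e i p) = 0"
    using b assms(4) by (intro independentD[of ?B ?B u]) auto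
  then show ?thesis using u[OF assms(4)] by simp
qed

lemma section_fibre: "s \<in> sections_on E U \<Longrightarrow> p \<in> U \<Longrightarrow> s p \<in> fibre E p"
  by (simp add: sections_on_def)

lemma sections_onE:
  assumes "s \<in> sections_on E U" "(V, r, e) \<in> frames E"
  obtains c where "\<And>i. i < r \<Longrightarrow> smooth_fun_on E (U \<inter> V) (c i)"
    "\<And>p. p \<in> U \<Longrightarrow> p \<in> V \<Longrightarrow> s p = (\<Sum>i<r. c i p *\<^sub>R e i p)"
  using assms unfolding sections_on_def by fastforce

lemma sections_onI:
  assumes "\<And>p. p \<in> U \<Longrightarrow> s p \<in> fibre E p"
    and "\<And>V r e. (V, r, e) \<in> frames E \<Longrightarrow> open V \<Longrightarrow> \<exists>c. (\<forall>i<r. smooth_fun_on E (U \<inter> V) (c i)) \<and>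
        (\<forall>p\<in>U \<inter> V. s p = (\<Sum>i<r. c i p *\<^sub>R e i p))"
  shows "s \<in> sections_on E U"
  using assms frames_open unfolding sections_on_def by fast

lemma sections_on_subset:
  assumes "s \<in> sections_on E U" "W \<subseteq> U"
  shows "s \<in> sections_on E W"
proof (rule sections_onI)
  show "s p \<in> fibre E p" if "p \<in> W" for p
    using that assms section_fibre by auto
  fix V r e assume V: "(V, r, e) \<in> frames E" "open V"
  obtain c where "\<And>i. i < r \<Longrightarrow> smooth_fun_on E (U \<inter> V) (c i)"
    "\<And>p. p \<in> U \<Longrightarrow> p \<in> V \<Longrightarrow> s p = (\<Sum>i<r. c i p *\<^sub>R e i p)"
    by (rule sections_onE[OF assms(1) V(1)]) blast
  then show "\<exists>c. (\<forall>i<r. smooth_fun_on E (W \<inter> V) (c i)) \<and> (\<forall>p\<in>W \<inter> V. s p = (\<Sum>i<r. c i p *\<^sub>R e i p))"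
    using assms(2) by (intro exI[of _ c]) (auto intro: smooth_fun_on_subset)
qed

lemma sections_on_cong:
  "s \<in> sections_on E U \<Longrightarrow> (\<And>p. p \<in> U \<Longrightarrow> s p = t p) \<Longrightarrow> t \<in> sections_on E U"
  unfolding sections_on_def by simp

lemma sections_on_zero: "(\<lambda>p. 0) \<in> sections_on E U"
  by (rule sections_onI)
    (auto simp: subspace_0[OF subspace_fibre] smooth_fun_on_const intro!: exI[of _ "\<lambda>i p. 0"])

lemma sections_on_add:
  assumes "open U" "s \<in> sections_on E U" "t \<in> sections_on E U"
  shows "(\<lambda>p. s p + t p) \<in> sections_on E U"
proof (rule sections_onI)
  show "s p + t p \<in> fibre E p" if "p \<in> U" for p
    using that assms by (intro subspace_add[OF subspace_fibre] section_fibre)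
  fix V r e assume V: "(V, r, e) \<in> frames E" "open V"
  obtain c where "\<And>i. i < r \<Longrightarrow> smooth_fun_on E (U \<inter> V) (c i)"
    "\<And>p. p \<in> U \<Longrightarrow> p \<in> V \<Longrightarrow> s p = (\<Sum>i<r. c i p *\<^sub>R e i p)"
    by (rule sections_onE[OF assms(2) V(1)]) blast
  moreover obtain d where "\<And>i. i < r \<Longrightarrow> smooth_fun_on E (U \<inter> V) (d i)"
    "\<And>p. p \<in> U \<Longrightarrow> p \<in> V \<Longrightarrow> t p = (\<Sum>i<r. d i p *\<^sub>R e i p)"
    by (rule sections_onE[OF assms(3) V(1)]) blast
  ultimately show "\<exists>c. (\<forall>i<r. smooth_fun_on E (U \<inter> V) (c i)) \<and>
        (\<forall>p\<in>U \<inter> V. s p + t p = (\<Sum>i<r. c i p *\<^sub>R e i p))"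
    using assms(1) V(2)
    by (intro exI[of _ "\<lambda>i p. c i p + d i p"]) (auto intro: smooth_fun_on_add simp: scaleR_left_distrib sum.distrib)
qed

lemma sections_on_scaleR:
  assumes "open U" "smooth_fun_on E U f" "s \<in> sections_on E U"
  shows "(\<lambda>p. f p *\<^sub>R s p) \<in> sections_on E U"
proof (rule sections_onI)
  show "f p *\<^sub>R s p \<in> fibre E p" if "p \<in> U" for p
    using that assms by (intro subspace_scale[OF subspace_fibre] section_fibre)
  fix V r e assume V: "(V, r, e) \<in> frames E" "open V"
  obtain c where "\<And>i. i < r \<Longrightarrow> smooth_fun_on E (U \<inter> V) (c i)"
    "\<And>p. p \<in> U \<Longrightarrow> p \<in> V \<Longrightarrow> s p = (\<Sum>i<r. c i p *\<^sub>R e i p)"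
    by (rule sections_onE[OF assms(3) V(1)]) blast
  then show "\<exists>c. (\<forall>i<r. smooth_fun_on E (U \<inter> V) (c i)) \<and>
        (\<forall>p\<in>U \<inter> V. f p *\<^sub>R s p = (\<Sum>i<r. c i p *\<^sub>R e i p))"
    using assms(1) V(2) smooth_fun_on_subset[OF assms(2), of "U \<inter> V"]
    by (intro exI[of _ "\<lambda>i p. f p * c i p"]) (auto intro: smooth_fun_on_mult simp: scaleR_sum_right)
qed

lemma sections_on_scaleR_const:
  "open U \<Longrightarrow> s \<in> sections_on E U \<Longrightarrow> (\<lambda>p. (a::real) *\<^sub>R s p) \<in> sections_on E U"
  by (rule sections_on_scaleR[OF _ smooth_fun_on_const])

lemma sections_on_minus:
  "open U \<Longrightarrow> s \<in> sections_on E U \<Longrightarrow> (\<lambda>p. - s p) \<in> sections_on E U"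
  using sections_on_scaleR_const[of U s "- 1"] by simp

lemma sections_on_diff:
  "open U \<Longrightarrow> s \<in> sections_on E U \<Longrightarrow> t \<in> sections_on E U \<Longrightarrow> (\<lambda>p. s p - t p) \<in> sections_on E U"
  using sections_on_add[OF _ _ sections_on_minus] by simp

lemma sections_on_sum:
  "open U \<Longrightarrow> (\<And>i. i \<in> A \<Longrightarrow> s i \<in> sections_on E U) \<Longrightarrow> (\<lambda>p. \<Sum>i\<in>A. s i p) \<in> sections_on E U"
  by (induction A rule: infinite_finite_induct) (auto simp: sections_on_zero sections_on_add)

lemma sections_on_local:
  assumes "\<And>p. p \<in> U \<Longrightarrow> \<exists>W. open W \<and> p \<in> W \<and> s \<in> sections_on E W"
  shows "s \<in> sections_on E U"
proof (rule sections_onI)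
  show "s p \<in> fibre E p" if "p \<in> U" for p
    using assms[OF that] section_fibre by auto
  fix V r e assume V: "(V, r, e) \<in> frames E" "open V"
  \<comment> \<open>a choice at each point; by uniqueness it agrees with the smooth coefficients near that point\<close>
  define c where "c i p = (SOME d. s p = (\<Sum>i<r. d i *\<^sub>R e i p)) i" for i p
  have c: "s p = (\<Sum>i<r. c i p *\<^sub>R e i p)" if "s p = (\<Sum>i<r. d i *\<^sub>R e i p)" for p d
    unfolding c_def by (rule someI[of _ d]) (rule that)
  have smooth: "\<exists>W. open W \<and> p \<in> W \<and> smooth_fun_on E W (c i) \<and> s p = (\<Sum>i<r. c i p *\<^sub>R e i p)"
    if p: "p \<in> U \<inter> V" and i: "i < r" for p i
  proof -
    obtain W where W: "open W" "p \<in> W" "s \<in> sections_on E W" using assms p by auto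
    obtain d where d: "\<And>i. i < r \<Longrightarrow> smooth_fun_on E (W \<inter> V) (d i)"
      "\<And>p. p \<in> W \<Longrightarrow> p \<in> V \<Longrightarrow> s p = (\<Sum>i<r. d i p *\<^sub>R e i p)"
      by (rule sections_onE[OF W(3) V(1)]) blast
    have "d i q = c i q" if "q \<in> W \<inter> V" for q
      using frame_coefficients_unique[OF V(1) _ _ i, of q "\<lambda>i. d i q" "\<lambda>i. c i q"] d(2) c that by auto
    then have "smooth_fun_on E (W \<inter> V) (c i)"
      using smooth_fun_on_cong[OF _ _ d(1)[OF i]] W V by blast
    then show ?thesis using W V p c[OF d(2)] by (intro exI[of _ "W \<inter> V"]) auto
  qed
  have "s p = (\<Sum>i<r. c i p *\<^sub>R e i p)" if "p \<in> U \<inter> V" for p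
  proof -
    obtain W where W: "p \<in> W" "s \<in> sections_on E W" using assms \<open>p \<in> U \<inter> V\<close> by blast
    with that show ?thesis using c by (metis IntD2 sections_onE[OF W(2) V(1)])
  qed
  moreover have "smooth_fun_on E (U \<inter> V) (c i)" if "i < r" for i
    by (rule smooth_fun_on_local) (use smooth that in blast)
  ultimately show "\<exists>c. (\<forall>i<r. smooth_fun_on E (U \<inter> V) (c i)) \<and>
      (\<forall>p\<in>U \<inter> V. s p = (\<Sum>i<r. c i p *\<^sub>R e i p))" by auto
qed

text \<open>
  Multiplication with a bump function extends local sections by zero. The values of \<open>s\<close> outside \<open>U\<close>
  are arbitrary but do not matter, as \<open>\<eta>\<close> vanishes there.
\<close>

lemma cutoff_sections:
  assumes "open U" "p \<in> U"
  obtains \<eta> where "\<eta> \<in> smooth_funs E" "\<eta> p = 1" "\<And>q. q \<notin> U \<Longrightarrow> \<eta> q = 0"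
    "\<And>s. s \<in> sections_on E U \<Longrightarrow> (\<lambda>q. \<eta> q *\<^sub>R s q) \<in> sections E"
proof -
  obtain \<eta> :: "'m \<Rightarrow> real" and C where \<eta>: "\<eta> \<in> smooth_funs E" "\<eta> p = 1" "closed C" "C \<subseteq> U"
    "\<And>q. q \<notin> C \<Longrightarrow> \<eta> q = 0"
    using bump_function[OF assms] by metis
  have "(\<lambda>q. \<eta> q *\<^sub>R s q) \<in> sections E" if s: "s \<in> sections_on E U" for s
  proof (rule sections_on_local)
    fix q
    have "(\<lambda>q. \<eta> q *\<^sub>R s q) \<in> sections_on E U"
      using \<eta>(1) assms(1) s smooth_fun_on_subset[of UNIV \<eta> U]
      by (intro sections_on_scaleR) (auto simp: smooth_funs_def)
    moreover have "(\<lambda>q. \<eta> q *\<^sub>R s q) \<in> sections_on E (- C)"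
      by (rule sections_on_cong[OF sections_on_zero]) (use \<eta>(5) in simp)
    ultimately show "\<exists>W. open W \<and> q \<in> W \<and> (\<lambda>q. \<eta> q *\<^sub>R s q) \<in> sections_on E W"
      using assms(1) \<eta>(3,4) by (cases "q \<in> U") (use open_Compl in blast)+
  qed
  then show thesis using that[of \<eta>] \<eta> by blast
qed

lemma section_through:
  assumes "u \<in> fibre E p"
  obtains s where "s \<in> sections E" "s p = u"
proof -
  from frames_cover have "p \<in> (\<Union>(V, r, e)\<in>frames E. V)" by simp
  then obtain V r e where V: "(V, r, e) \<in> frames E" "p \<in> V" by auto
  have "u \<in> span ((\<lambda>i. e i p) ` {..<r})" "inj_on (\<lambda>i. e i p) {..<r}"
    using frames_basis[OF V] assms by auto
  then obtain c where c: "u = (\<Sum>i<r. c (e i p) *\<^sub>R e i p)"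
    by (auto simp: span_finite sum.reindex)
  obtain \<eta> where \<eta>: "\<eta> p = (1::real)"
    "\<And>s. s \<in> sections_on E V \<Longrightarrow> (\<lambda>q. \<eta> q *\<^sub>R s q) \<in> sections E"
    using cutoff_sections[OF frames_open[OF V(1)] V(2)] by metis
  have "(\<lambda>q. \<Sum>i<r. c (e i p) *\<^sub>R e i q) \<in> sections_on E V"
    using frames_open[OF V(1)] frames_smooth[OF V(1)]
    by (intro sections_on_sum sections_on_scaleR_const) auto
  from that[OF \<eta>(2)[OF this]] show thesis using c \<eta>(1) by simp
qed

end

section \<open>The complexified Courant algebroid\<close>

lemma linear_onD:
  assumes "linear_on S g" "u \<in> S" "v \<in> S"
  shows "g (u + v) = g u + g v" "g (a *\<^sub>R u) = a *\<^sub>R g u"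
  using assms by (auto simp: linear_on_def)

lemma conj_vec_simps [simp]:
  "conj_vec (conj_vec u) = u" "conj_vec (u + v) = conj_vec u + conj_vec v"
  "conj_vec (- u) = - conj_vec u" "conj_vec (u - v) = conj_vec u - conj_vec v"
  "conj_vec (c *\<^sub>C u) = cnj c *\<^sub>C conj_vec u"
  by (auto simp: conj_vec_def cscale_def)

lemma cscale_minus_one: "(- 1) *\<^sub>C u = - u"
  by (simp add: cscale_def prod_eq_iff)

context vector_bundle
begin

lemmas fibre_closed =
  subspace_0[OF subspace_fibre] subspace_add[OF subspace_fibre] subspace_scale[OF subspace_fibre]
  subspace_neg[OF subspace_fibre] subspace_diff[OF subspace_fibre]

lemma mem_cfibre: "u \<in> cfibre E p \<longleftrightarrow> fst u \<in> fibre E p \<and> snd u \<in> fibre E p"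
  by (cases u) (simp add: cfibre_def)

lemma cfibre_closed:
  "0 \<in> cfibre E p"
  "u \<in> cfibre E p \<Longrightarrow> v \<in> cfibre E p \<Longrightarrow> u + v \<in> cfibre E p"
  "u \<in> cfibre E p \<Longrightarrow> c *\<^sub>C u \<in> cfibre E p"
  "u \<in> cfibre E p \<Longrightarrow> - u \<in> cfibre E p"
  "u \<in> cfibre E p \<Longrightarrow> v \<in> cfibre E p \<Longrightarrow> u - v \<in> cfibre E p"
  "u \<in> cfibre E p \<Longrightarrow> conj_vec u \<in> cfibre E p"
  by (auto simp: mem_cfibre fibre_closed cscale_def conj_vec_def)

lemma csections_on_cfibre:
  "s \<in> csections_on E (cfibre E) U \<longleftrightarrow>
    (\<lambda>p. fst (s p)) \<in> sections_on E U \<and> (\<lambda>p. snd (s p)) \<in> sections_on E U"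
  by (auto simp: csections_on_def o_def mem_cfibre dest: section_fibre)

lemma csections_on_cfibreD: "s \<in> csections_on E B U \<Longrightarrow> s \<in> csections_on E (cfibre E) U"
  unfolding csections_on_cfibre by (simp add: csections_on_def o_def)

lemma csections_onI:
  "s \<in> csections_on E (cfibre E) U \<Longrightarrow> (\<And>p. p \<in> U \<Longrightarrow> s p \<in> B p) \<Longrightarrow> s \<in> csections_on E B U"
  by (simp add: csections_on_def)

lemma csections_on_mem: "s \<in> csections_on E B U \<Longrightarrow> p \<in> U \<Longrightarrow> s p \<in> B p"
  by (simp add: csections_on_def)

lemma csection_cases:
  assumes "s \<in> csections E B"
  obtains a b where "s = (\<lambda>p. (a p, b p))" "a \<in> sections E" "b \<in> sections E"
  using that[of "\<lambda>p. fst (s p)" "\<lambda>p. snd (s p)"] csections_on_cfibreD[OF assms]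
  by (simp add: csections_on_cfibre)

lemma csections_on_add:
  "open U \<Longrightarrow> s \<in> csections_on E (cfibre E) U \<Longrightarrow> t \<in> csections_on E (cfibre E) U \<Longrightarrow>
    (\<lambda>p. s p + t p) \<in> csections_on E (cfibre E) U"
  by (simp add: csections_on_cfibre sections_on_add)

lemma csections_on_cscale:
  assumes "open U" "smooth_fun_on E U (f :: 'm \<Rightarrow> complex)" "s \<in> csections_on E (cfibre E) U"
  shows "(\<lambda>p. f p *\<^sub>C s p) \<in> csections_on E (cfibre E) U"
proof -
  have "smooth_fun_on E U (\<lambda>p. Re (f p))" "smooth_fun_on E U (\<lambda>p. Im (f p))"
    using smooth_fun_on_bounded_linear[OF assms(1) bounded_linear_Re assms(2)]
      smooth_fun_on_bounded_linear[OF assms(1) bounded_linear_Im assms(2)] by simp_all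
  then show ?thesis
    using assms by (simp add: csections_on_cfibre cscale_def sections_on_add sections_on_diff sections_on_scaleR)
qed

lemma csections_on_cscale_const:
  "open U \<Longrightarrow> s \<in> csections_on E (cfibre E) U \<Longrightarrow> (\<lambda>p. a *\<^sub>C s p) \<in> csections_on E (cfibre E) U"
  by (rule csections_on_cscale[OF _ smooth_fun_on_const])

lemma csections_on_minus:
  "open U \<Longrightarrow> s \<in> csections_on E (cfibre E) U \<Longrightarrow> (\<lambda>p. - s p) \<in> csections_on E (cfibre E) U"
  using csections_on_cscale_const[of U s "- 1"] by (simp only: cscale_minus_one)

lemma csections_on_diff:
  "open U \<Longrightarrow> s \<in> csections_on E (cfibre E) U \<Longrightarrow> t \<in> csections_on E (cfibre E) U \<Longrightarrow>
    (\<lambda>p. s p - t p) \<in> csections_on E (cfibre E) U"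
  using csections_on_add[OF _ _ csections_on_minus] by simp

lemma csections_on_sum:
  "open U \<Longrightarrow> (\<And>i. i \<in> A \<Longrightarrow> s i \<in> csections_on E (cfibre E) U) \<Longrightarrow>
    (\<lambda>p. \<Sum>i\<in>A. s i p) \<in> csections_on E (cfibre E) U"
  by (simp add: csections_on_cfibre fst_sum snd_sum sections_on_sum)

lemma csections_on_conj:
  "open U \<Longrightarrow> s \<in> csections_on E (cfibre E) U \<Longrightarrow> (\<lambda>p. conj_vec (s p)) \<in> csections_on E (cfibre E) U"
  by (simp add: csections_on_cfibre conj_vec_def sections_on_minus)

lemma csections_on_local:
  assumes "\<And>p. p \<in> U \<Longrightarrow> \<exists>W. open W \<and> p \<in> W \<and> s \<in> csections_on E (cfibre E) W"
  shows "s \<in> csections_on E (cfibre E) U"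
proof -
  have "(\<lambda>p. fst (s p)) \<in> sections_on E U" "(\<lambda>p. snd (s p)) \<in> sections_on E U"
    using assms unfolding csections_on_cfibre by (blast intro!: sections_on_local[of U "\<lambda>p. fst (s p)"]
      sections_on_local[of U "\<lambda>p. snd (s p)"])+
  then show ?thesis by (simp add: csections_on_cfibre)
qed

lemma csections_on_cong:
  assumes "s \<in> csections_on E B U" "\<And>p. p \<in> U \<Longrightarrow> s p = t p"
  shows "t \<in> csections_on E B U"
  using assms sections_on_cong[of "fst \<circ> s" U "fst \<circ> t"] sections_on_cong[of "snd \<circ> s" U "snd \<circ> t"]
  by (simp add: csections_on_def)

lemma csection_extension:
  assumes "open U" "p \<in> U" "s \<in> csections_on E B U" "\<And>q. csubspace (B q)"
  obtains t where "t \<in> csections E B" "t p = s p"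
proof -
  obtain \<eta> where \<eta>: "\<eta> p = (1::real)" "\<And>q. q \<notin> U \<Longrightarrow> \<eta> q = 0"
    "\<And>s. s \<in> sections_on E U \<Longrightarrow> (\<lambda>q. \<eta> q *\<^sub>R s q) \<in> sections E"
    using cutoff_sections[OF assms(1,2)] by metis
  let ?t = "\<lambda>q. complex_of_real (\<eta> q) *\<^sub>C s q"
  have mem: "?t q \<in> B q" for q
  proof (cases "q \<in> U")
    case True
    then show ?thesis by (intro cvec.subspace_scale assms(4) csections_on_mem[OF assms(3)])
  next
    case False
    then show ?thesis using cvec.subspace_0[OF assms(4)[of q]] by (simp add: \<eta>(2))
  qed
  have "?t \<in> csections E (cfibre E)"
    using csections_on_cfibreD[OF assms(3)] by (simp add: csections_on_cfibre cscale_def \<eta>(3))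
  from csections_onI[OF this mem] have "?t \<in> csections E B" .
  moreover have "?t p = s p" by (simp add: \<eta>(1))
  ultimately show thesis by (rule that)
qed

text \<open>
  With this, an identity that holds against all global sections holds fibrewise.
\<close>

lemma csection_through:
  assumes "u \<in> cfibre E p"
  obtains s where "s \<in> csections E (cfibre E)" "s p = u"
proof -
  obtain a b where "a \<in> sections E" "a p = fst u" "b \<in> sections E" "b p = snd u"
    using assms section_through by (metis mem_cfibre)
  then show thesis using that[of "\<lambda>p. (a p, b p)"] by (simp add: csections_on_cfibre)
qed

end

context courant_algebroid
begin

lemma smooth_funs_parts:
  assumes "f \<in> smooth_funs E"
  shows "(\<lambda>p. Re (f p)) \<in> smooth_funs E" "(\<lambda>p. Im (f p)) \<in> smooth_funs E"
  using smooth_fun_on_bounded_linear[OF open_UNIV bounded_linear_Re, of f]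
    smooth_fun_on_bounded_linear[OF open_UNIV bounded_linear_Im, of f] assms
  by (auto simp: smooth_funs_def)

lemma pairing_lin:
  assumes "u \<in> fibre E p" "v \<in> fibre E p" "w \<in> fibre E p"
  shows "pairing E p (u + v) w = pairing E p u w + pairing E p v w"
    "pairing E p w (u + v) = pairing E p w u + pairing E p w v"
    "pairing E p (a *\<^sub>R u) w = a * pairing E p u w"
    "pairing E p w (a *\<^sub>R u) = a * pairing E p w u"
    "pairing E p (- u) w = - pairing E p u w"
    "pairing E p w (- u) = - pairing E p w u"
    "pairing E p (u - v) w = pairing E p u w - pairing E p v w"
    "pairing E p w (u - v) = pairing E p w u - pairing E p w v"
proof -
  have add: "pairing E p (x + y) w = pairing E p x w + pairing E p y w"
    and scale: "pairing E p (b *\<^sub>R x) w = b * pairing E p x w"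
    if "x \<in> fibre E p" "y \<in> fibre E p" for x y b
    using linear_onD[OF pairing_linear[OF assms(3)]] that by simp_all
  have neg: "pairing E p (- x) w = - pairing E p x w" if "x \<in> fibre E p" for x
    using scale[OF that that, of "- 1"] by simp
  have diff: "pairing E p (u - v) w = pairing E p u w - pairing E p v w"
    using add[of u "- v"] neg[of v] assms fibre_closed(4) by simp
  note sym = pairing_sym[OF assms(3)]
  show "pairing E p (u + v) w = pairing E p u w + pairing E p v w"
    "pairing E p w (u + v) = pairing E p w u + pairing E p w v"
    "pairing E p (a *\<^sub>R u) w = a * pairing E p u w"
    "pairing E p w (a *\<^sub>R u) = a * pairing E p w u"
    "pairing E p (- u) w = - pairing E p u w"
    "pairing E p w (- u) = - pairing E p w u"
    "pairing E p (u - v) w = pairing E p u w - pairing E p v w"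
    "pairing E p w (u - v) = pairing E p w u - pairing E p w v"
    using add scale neg diff sym assms by (auto simp: fibre_closed)
qed

lemma cpairing_lin:
  assumes "u \<in> cfibre E p" "v \<in> cfibre E p" "w \<in> cfibre E p"
  shows "cpairing E p (u + v) w = cpairing E p u w + cpairing E p v w"
    "cpairing E p w (u + v) = cpairing E p w u + cpairing E p w v"
    "cpairing E p (c *\<^sub>C u) w = c * cpairing E p u w"
    "cpairing E p w (c *\<^sub>C u) = c * cpairing E p w u"
    "cpairing E p (- u) w = - cpairing E p u w"
    "cpairing E p w (- u) = - cpairing E p w u"
    "cpairing E p (u - v) w = cpairing E p u w - cpairing E p v w"
    "cpairing E p w (u - v) = cpairing E p w u - cpairing E p w v"
  using assms
  by (auto simp: cpairing_def mem_cfibre cscale_def complex_eq_iff pairing_lin fibre_closed algebra_simps)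

lemma cpairing_conj:
  assumes "u \<in> cfibre E p" "v \<in> cfibre E p"
  shows "cpairing E p (conj_vec u) (conj_vec v) = cnj (cpairing E p u v)"
  using assms
  by (auto simp: cpairing_def mem_cfibre conj_vec_def complex_eq_iff pairing_lin fibre_closed algebra_simps)

lemma cpairing_zero:
  assumes "u \<in> cfibre E p"
  shows "cpairing E p 0 u = 0" "cpairing E p u 0 = 0"
  using cpairing_lin(7,8)[OF assms assms assms] by simp_all

lemma cpairing_nondegenerate:
  assumes "u \<in> cfibre E p" "\<And>v. v \<in> cfibre E p \<Longrightarrow> cpairing E p u v = 0"
  shows "u = 0"
proof -
  have u: "fst u \<in> fibre E p" "snd u \<in> fibre E p" using assms(1) by (simp_all add: mem_cfibre)
  have "pairing E p (fst u) v = 0 \<and> pairing E p (snd u) v = 0" if v: "v \<in> fibre E p" for v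
  proof -
    have "pairing E p w 0 = 0" if "w \<in> fibre E p" for w
      using pairing_lin(8)[OF that that that] by simp
    then show ?thesis
      using assms(2)[of "(v, 0)"] u v by (simp add: cpairing_def mem_cfibre fibre_closed complex_eq_iff)
  qed
  then show ?thesis using u pairing_nondegenerate by (auto simp: prod_eq_iff)
qed

lemma cpairing_smooth:
  assumes "open U" "x \<in> csections_on E (cfibre E) U" "y \<in> csections_on E (cfibre E) U"
  shows "smooth_fun_on E U (\<lambda>p. cpairing E p (x p) (y p))"
proof -
  note s = pairing_smooth[OF assms(1)] assms(2,3)[unfolded csections_on_cfibre]
  let ?c = "\<lambda>p. complex_of_real (pairing E p (fst (x p)) (fst (y p)) - pairing E p (snd (x p)) (snd (y p)))
    + complex_of_real (pairing E p (fst (x p)) (snd (y p)) + pairing E p (snd (x p)) (fst (y p))) * \<i>"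
  have "smooth_fun_on E U ?c"
    by (intro smooth_fun_on_add smooth_fun_on_mult smooth_fun_on_const assms(1)
        smooth_fun_on_bounded_linear[OF assms(1) bounded_linear_of_real] smooth_fun_on_diff)
      (use s in auto)
  then show ?thesis
    by (rule smooth_fun_on_cong[OF assms(1), rotated]) (simp add: cpairing_def complex_eq_iff)
qed

lemma anchor_fun_lin:
  assumes "u \<in> fibre E p" "f \<in> smooth_funs E" "g \<in> smooth_funs E"
  shows "anchor E p u (\<lambda>q. f q + g q) = anchor E p u f + anchor E p u g"
    "anchor E p u (\<lambda>q. - f q) = - anchor E p u f"
    "anchor E p u (\<lambda>q. f q - g q) = anchor E p u f - anchor E p u g"
proof -
  note t = anchor_tangent[OF assms(1), unfolded tangent_vector_def]
  have neg: "anchor E p u (\<lambda>q. - h q) = - anchor E p u h" if "h \<in> smooth_funs E" for h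
    using t that by (auto dest!: spec[of _ "- 1"])
  have "(\<lambda>q. - g q) \<in> smooth_funs E"
    using assms(3) smooth_fun_on_bounded_linear[OF open_UNIV bounded_linear_minus[OF bounded_linear_ident], of g]
    by (simp add: smooth_funs_def)
  then show "anchor E p u (\<lambda>q. f q + g q) = anchor E p u f + anchor E p u g"
    "anchor E p u (\<lambda>q. - f q) = - anchor E p u f"
    "anchor E p u (\<lambda>q. f q - g q) = anchor E p u f - anchor E p u g"
    using t neg assms by (auto simp only: diff_conv_add_uminus)
qed

lemma const_smooth: "(\<lambda>p. a) \<in> smooth_funs E"
  by (simp add: smooth_funs_def smooth_fun_on_const)

lemma canchor_const:
  assumes "u \<in> cfibre E p"
  shows "canchor E p u (\<lambda>q. a) = 0"
proof -
  have "anchor E p w (\<lambda>q. c) = 0" if w: "w \<in> fibre E p" for w and c :: real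
  proof -
    note t = anchor_tangent[OF w, unfolded tangent_vector_def]
    have one: "(\<lambda>q. 1::real) \<in> smooth_funs E" by (rule const_smooth)
    have "anchor E p w (\<lambda>q. 1 * 1) = 1 * anchor E p w (\<lambda>q. 1) + 1 * anchor E p w (\<lambda>q. 1)"
      using bspec[OF bspec[OF conjunct2[OF conjunct2[OF t]] one] one] .
    moreover have "anchor E p w (\<lambda>q. c * 1) = c * anchor E p w (\<lambda>q. 1)"
      using bspec[OF spec[OF conjunct1[OF conjunct2[OF t]]] one] .
    ultimately show ?thesis by simp
  qed
  then show ?thesis
    using assms by (simp add: canchor_def mem_cfibre o_def complex_eq_iff)
qed

lemma dorfman_minus_left:
  "x \<in> sections E \<Longrightarrow> y \<in> sections E \<Longrightarrow> dorfman E (\<lambda>p. - x p) y = (\<lambda>p. - dorfman E x y p)"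
  using dorfman_scale_left[of x y "- 1"] by simp

lemma dorfman_minus_right:
  "x \<in> sections E \<Longrightarrow> y \<in> sections E \<Longrightarrow> dorfman E x (\<lambda>p. - y p) = (\<lambda>p. - dorfman E x y p)"
  using dorfman_scale_right[of x y "- 1"] by simp

lemma dorfman_diff_left:
  assumes "x \<in> sections E" "y \<in> sections E" "z \<in> sections E"
  shows "dorfman E (\<lambda>p. x p - y p) z = (\<lambda>p. dorfman E x z p - dorfman E y z p)"
  using dorfman_add_left[OF assms(1) sections_on_minus[OF open_UNIV assms(2)] assms(3)]
    dorfman_minus_left[OF assms(2,3)] by simp

lemma dorfman_diff_right:
  assumes "x \<in> sections E" "y \<in> sections E" "z \<in> sections E"
  shows "dorfman E x (\<lambda>p. y p - z p) = (\<lambda>p. dorfman E x y p - dorfman E x z p)"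
  using dorfman_add_right[OF assms(1,2) sections_on_minus[OF open_UNIV assms(3)]]
    dorfman_minus_right[OF assms(1,3)] by simp

lemmas section_closed =
  sections_on_add[OF open_UNIV] sections_on_diff[OF open_UNIV] sections_on_minus[OF open_UNIV]
  sections_on_scaleR_const[OF open_UNIV] dorfman_closed

lemmas dorfman_bilinear =
  dorfman_add_left dorfman_add_right dorfman_diff_left dorfman_diff_right dorfman_minus_left
  dorfman_minus_right dorfman_scale_left dorfman_scale_right section_closed

lemma cdorfman_pair:
  "cdorfman E (\<lambda>p. (a p, b p)) (\<lambda>p. (c p, d p)) =
    (\<lambda>p. (dorfman E a c p - dorfman E b d p, dorfman E a d p + dorfman E b c p))"
  by (simp add: cdorfman_def o_def)

lemma cdorfman_closed:
  assumes "x \<in> csections E A" "y \<in> csections E B"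
  shows "cdorfman E x y \<in> csections E (cfibre E)"
  using assms by (elim csection_cases) (simp add: cdorfman_pair csections_on_cfibre section_closed)

lemma cdorfman_add_left:
  assumes "x \<in> csections E A" "y \<in> csections E B" "z \<in> csections E C"
  shows "cdorfman E (\<lambda>p. x p + y p) z = (\<lambda>p. cdorfman E x z p + cdorfman E y z p)"
  using assms by (elim csection_cases) (simp add: cdorfman_pair dorfman_bilinear algebra_simps)

lemma cdorfman_add_right:
  assumes "x \<in> csections E A" "y \<in> csections E B" "z \<in> csections E C"
  shows "cdorfman E x (\<lambda>p. y p + z p) = (\<lambda>p. cdorfman E x y p + cdorfman E x z p)"
  using assms by (elim csection_cases) (simp add: cdorfman_pair dorfman_bilinear algebra_simps)

lemma cdorfman_cscale_left:
  assumes "x \<in> csections E A" "y \<in> csections E B"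
  shows "cdorfman E (\<lambda>p. c *\<^sub>C x p) y = (\<lambda>p. c *\<^sub>C cdorfman E x y p)"
  using assms by (elim csection_cases) (simp add: cdorfman_pair cscale_def dorfman_bilinear algebra_simps)

lemma cdorfman_jacobi:
  assumes "x \<in> csections E A" "y \<in> csections E B" "z \<in> csections E C"
  shows "cdorfman E x (cdorfman E y z) =
    (\<lambda>p. cdorfman E (cdorfman E x y) z p + cdorfman E y (cdorfman E x z) p)"
proof -
  obtain a b where x: "x = (\<lambda>p. (a p, b p))" and ab: "a \<in> sections E" "b \<in> sections E"
    using assms(1) by (rule csection_cases)
  obtain c d where y: "y = (\<lambda>p. (c p, d p))" and cd: "c \<in> sections E" "d \<in> sections E"
    using assms(2) by (rule csection_cases)
  obtain e f where z: "z = (\<lambda>p. (e p, f p))" and ef: "e \<in> sections E" "f \<in> sections E"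
    using assms(3) by (rule csection_cases)
  note jac = dorfman_jacobi[OF ab(1) cd(1)] dorfman_jacobi[OF ab(1) cd(2)]
    dorfman_jacobi[OF ab(2) cd(1)] dorfman_jacobi[OF ab(2) cd(2)]
  show ?thesis
    using ab cd ef
    by (simp add: x y z cdorfman_pair dorfman_bilinear jac[OF ef(1)] jac[OF ef(2)] algebra_simps)
qed

lemma cdorfman_leibniz:
  fixes f :: "'m \<Rightarrow> complex"
  assumes "x \<in> csections E A" "y \<in> csections E B" "f \<in> smooth_funs E"
  shows "cdorfman E x (\<lambda>p. f p *\<^sub>C y p) = (\<lambda>p. canchor_der E x f p *\<^sub>C y p + f p *\<^sub>C cdorfman E x y p)"
proof -
  have s: "(\<lambda>p. g p *\<^sub>R a p) \<in> sections E" if "g \<in> smooth_funs E" "a \<in> sections E" for g :: "'m \<Rightarrow> real" and a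
    using that by (intro sections_on_scaleR) (auto simp: smooth_funs_def)
  show ?thesis
    using assms(1,2) smooth_funs_parts[OF assms(3)]
    by (elim csection_cases)
      (simp add: cdorfman_pair cscale_def canchor_def o_def s dorfman_bilinear dorfman_leibniz algebra_simps)
qed

lemma cdorfman_pairing:
  assumes "x \<in> csections E A" "y \<in> csections E B" "z \<in> csections E C"
  shows "canchor_der E x (\<lambda>q. cpairing E q (y q) (z q)) p =
    cpairing E p (cdorfman E x y p) (z p) + cpairing E p (y p) (cdorfman E x z p)"
proof -
  have sm: "pairing_fun E a b \<in> smooth_funs E" if "a \<in> sections E" "b \<in> sections E" for a b
    using that pairing_smooth by (simp add: smooth_funs_def)
  have der: "anchor E p (a p) (pairing_fun E b c) =
      pairing E p (dorfman E a b p) (c p) + pairing E p (b p) (dorfman E a c p)"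
    if "a \<in> sections E" "b \<in> sections E" "c \<in> sections E" for a b c
    using dorfman_pairing[OF that] by (rule fun_cong)
  have fib: "a p \<in> fibre E p" if "a \<in> sections E" for a
    using section_fibre[OF that] by simp
  show ?thesis
    using assms
    by (elim csection_cases)
      (simp add: cdorfman_pair canchor_def cpairing_def o_def anchor_fun_lin sm der fib section_closed
        pairing_lin dorfman_closed complex_eq_iff)
qed

text \<open>
  The symmetric part of \<open>\<circ>\<close> is \<open>2\<D>\<langle>x, y\<rangle>\<close>. Instead of extending \<open>\<D>\<close> to complex functions, one compares the
  symmetric parts of pairs of real sections that have the same pairing function: if \<open>x = a + \<i> b\<close> and
  \<open>y = c + \<i> d\<close>, then \<open>\<langle>x, y\<rangle> = 0\<close> means \<open>\<langle>a, c\<rangle> = \<langle>b, d\<rangle>\<close> and \<open>\<langle>a, d\<rangle> = \<langle>- b, c\<rangle>\<close>.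
\<close>

lemma cdorfman_skew:
  assumes "x \<in> csections E A" "y \<in> csections E B" "\<And>p. cpairing E p (x p) (y p) = 0"
  shows "cdorfman E y x = (\<lambda>p. - cdorfman E x y p)"
proof -
  obtain a b where x: "x = (\<lambda>p. (a p, b p))" and ab: "a \<in> sections E" "b \<in> sections E"
    using assms(1) by (rule csection_cases)
  obtain c d where y: "y = (\<lambda>p. (c p, d p))" and cd: "c \<in> sections E" "d \<in> sections E"
    using assms(2) by (rule csection_cases)
  have fib: "s p \<in> fibre E p" if "s \<in> sections E" for s p
    using section_fibre[OF that] by simp
  have sym: "dorfman E s t p + dorfman E t s p = 2 *\<^sub>R courant_D E (pairing_fun E s t) p"
    if "s \<in> sections E" "t \<in> sections E" for s t p
    using dorfman_symmetric_part[OF that] by (rule fun_cong)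
  have "pairing_fun E a c = pairing_fun E b d"
    and im: "pairing_fun E (\<lambda>p. - b p) c = pairing_fun E a d"
    using assms(3) ab cd
    by (auto simp: x y cpairing_def complex_eq_iff fun_eq_iff pairing_lin[OF fib fib fib] minus_unique add.commute)
  then have 1: "dorfman E a c p + dorfman E c a p = dorfman E b d p + dorfman E d b p" for p
    using ab cd by (simp add: sym)
  have "dorfman E (\<lambda>p. - b p) c p + dorfman E c (\<lambda>p. - b p) p = dorfman E a d p + dorfman E d a p" for p
    using im ab cd by (simp add: sym section_closed)
  then have 2: "- (dorfman E b c p + dorfman E c b p) = dorfman E a d p + dorfman E d a p" for p
    using ab cd by (simp add: dorfman_bilinear)
  show ?thesis
    using 1 2 by (auto simp: x y cdorfman_pair fun_eq_iff algebra_simps eq_neg_iff_add_eq_0)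
qed

lemma sharp_eqI:
  assumes "w \<in> cfibre E p" "\<And>v. v \<in> cfibre E p \<Longrightarrow> \<omega> p u v = cpairing E p w v"
  shows "sharp E \<omega> p u = w"
  unfolding sharp_def
proof (rule the_equality)
  show "w \<in> cfibre E p \<and> (\<forall>v\<in>cfibre E p. \<omega> p u v = cpairing E p w v)"
    using assms by simp
  fix w' assume w': "w' \<in> cfibre E p \<and> (\<forall>v\<in>cfibre E p. \<omega> p u v = cpairing E p w' v)"
  have "w' - w = 0"
    by (rule cpairing_nondegenerate[of _ p]) (use w' assms in \<open>auto simp: cfibre_closed cpairing_lin\<close>)
  then show "w' = w" by simp
qed

end

section \<open>The eigenbundles of a complex structure\<close>

context complex_structure
begin

abbreviation (input) "JC \<equiv> cextend J"

lemma cextend_closed: "u \<in> cfibre E p \<Longrightarrow> JC p u \<in> cfibre E p"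
  by (simp add: mem_cfibre cextend_def J_fibre)

lemma J_lin:
  assumes "u \<in> fibre E p" "v \<in> fibre E p"
  shows "J p (u + v) = J p u + J p v" "J p (a *\<^sub>R u) = a *\<^sub>R J p u" "J p (- u) = - J p u"
    "J p (u - v) = J p u - J p v"
proof -
  note add = linear_onD(1)[OF J_linear] and scale = linear_onD(2)[OF J_linear]
  have neg: "J p (- x) = - J p x" if "x \<in> fibre E p" for x
    using scale[OF that that, of "- 1"] by simp
  show "J p (u + v) = J p u + J p v" "J p (a *\<^sub>R u) = a *\<^sub>R J p u" "J p (- u) = - J p u"
    using add scale neg assms by auto
  show "J p (u - v) = J p u - J p v"
    using add[OF assms(1) fibre_closed(4)[OF assms(2)]] neg[OF assms(2)] by simp
qed

lemma cextend_lin: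
  assumes "u \<in> cfibre E p" "v \<in> cfibre E p"
  shows "JC p (u + v) = JC p u + JC p v" "JC p (c *\<^sub>C u) = c *\<^sub>C JC p u" "JC p (- u) = - JC p u"
    "JC p (u - v) = JC p u - JC p v"
  using assms by (auto simp: mem_cfibre cextend_def cscale_def J_lin fibre_closed)

lemma cextend_square: "u \<in> cfibre E p \<Longrightarrow> JC p (JC p u) = - u"
  by (simp add: mem_cfibre cextend_def J_square prod_eq_iff)

lemma cextend_orthogonal:
  "u \<in> cfibre E p \<Longrightarrow> v \<in> cfibre E p \<Longrightarrow> cpairing E p (JC p u) (JC p v) = cpairing E p u v"
  by (simp add: mem_cfibre cextend_def cpairing_def J_orthogonal)

lemma cextend_conj: "u \<in> cfibre E p \<Longrightarrow> JC p (conj_vec u) = conj_vec (JC p u)"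
  by (simp add: mem_cfibre cextend_def conj_vec_def J_lin(3)[of "snd u" p "snd u"])

lemma csections_cextend:
  "x \<in> csections E (cfibre E) \<Longrightarrow> (\<lambda>p. JC p (x p)) \<in> csections E (cfibre E)"
  by (simp add: csections_on_cfibre cextend_def J_smooth)

lemma L_ofD: "u \<in> L_of E J p \<Longrightarrow> u \<in> cfibre E p" "u \<in> L_of E J p \<Longrightarrow> JC p u = \<i> *\<^sub>C u"
  by (auto simp: L_of_def)

lemma Lstar_ofD:
  "u \<in> Lstar_of E J p \<Longrightarrow> u \<in> cfibre E p" "u \<in> Lstar_of E J p \<Longrightarrow> JC p u = (- \<i>) *\<^sub>C u"
  by (auto simp: Lstar_of_def)

lemma cextend_zero: "JC p 0 = 0"
  using cextend_lin(4)[OF cfibre_closed(1,1)] by simp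

lemma csubspace_L_of: "csubspace (L_of E J p)"
  by (auto simp: cvec.subspace_def L_of_def cfibre_closed cextend_lin cvec.scale_right_distrib mult.commute
      cextend_zero)

lemma csubspace_Lstar_of: "csubspace (Lstar_of E J p)"
  by (auto simp: cvec.subspace_def Lstar_of_def cfibre_closed cextend_lin cvec.scale_right_distrib mult.commute
      cextend_zero)

text \<open>
  Orthogonality of \<open>J\<close> gives \<open>\<langle>u, v\<rangle> = \<langle>\<i> u, \<i> v\<rangle> = - \<langle>u, v\<rangle>\<close>.
\<close>

lemma L_of_isotropic:
  assumes "u \<in> L_of E J p" "v \<in> L_of E J p"
  shows "cpairing E p u v = 0"
proof -
  note c = L_ofD(1)[OF assms(1)] L_ofD(1)[OF assms(2)]
  have "cpairing E p u v = cpairing E p (\<i> *\<^sub>C u) (\<i> *\<^sub>C v)"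
    using cextend_orthogonal[OF c] assms by (simp add: L_ofD)
  also have "\<dots> = - cpairing E p u v"
    using c by (simp add: cpairing_lin[OF c(1,1)] cpairing_lin[OF c(2,2)] cfibre_closed)
  finally show ?thesis by simp
qed

lemma Lstar_of_isotropic:
  assumes "u \<in> Lstar_of E J p" "v \<in> Lstar_of E J p"
  shows "cpairing E p u v = 0"
proof -
  note c = Lstar_ofD(1)[OF assms(1)] Lstar_ofD(1)[OF assms(2)]
  have "cpairing E p u v = cpairing E p ((- \<i>) *\<^sub>C u) ((- \<i>) *\<^sub>C v)"
    using cextend_orthogonal[OF c] assms by (simp only: Lstar_ofD)
  also have "\<dots> = - cpairing E p u v"
    using c by (simp only: cpairing_lin(3)[OF c(1,1)] cpairing_lin(4)[OF c(2,2)] cfibre_closed) simp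
  finally show ?thesis by simp
qed

lemma conj_L_of: "u \<in> L_of E J p \<Longrightarrow> conj_vec u \<in> Lstar_of E J p"
  by (simp add: L_of_def Lstar_of_def cextend_conj cfibre_closed)

lemma conj_Lstar_of: "u \<in> Lstar_of E J p \<Longrightarrow> conj_vec u \<in> L_of E J p"
  by (simp add: L_of_def Lstar_of_def cextend_conj cfibre_closed)

lemma eigenprojections:
  assumes "u \<in> cfibre E p"
  shows "u - \<i> *\<^sub>C JC p u \<in> L_of E J p" "u + \<i> *\<^sub>C JC p u \<in> Lstar_of E J p"
  using assms
  by (auto simp: L_of_def Lstar_of_def cextend_lin cextend_closed cextend_square cfibre_closed
      cvec.scale_right_distrib cvec.scale_right_diff_distrib)

lemma eigenbundle_decomposition:
  assumes "u \<in> cfibre E p"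
  obtains a b where "a \<in> L_of E J p" "b \<in> Lstar_of E J p" "u = a + b"
proof
  show "(1/2) *\<^sub>C (u - \<i> *\<^sub>C JC p u) \<in> L_of E J p" "(1/2) *\<^sub>C (u + \<i> *\<^sub>C JC p u) \<in> Lstar_of E J p"
    using eigenprojections[OF assms] by (simp_all add: cvec.subspace_scale csubspace_L_of csubspace_Lstar_of)
  show "u = (1/2) *\<^sub>C (u - \<i> *\<^sub>C JC p u) + (1/2) *\<^sub>C (u + \<i> *\<^sub>C JC p u)"
    unfolding cvec.scale_right_distrib[symmetric] by (simp add: prod_eq_iff cscale_def)
qed

lemma Lstar_section_through:
  assumes "u \<in> Lstar_of E J p"
  obtains s where "s \<in> csections E (Lstar_of E J)" "s p = u"
proof -
  obtain t where t: "t \<in> csections E (cfibre E)" "t p = u"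
    using csection_through[OF Lstar_ofD(1)[OF assms]] .
  let ?s = "\<lambda>q. (1/2) *\<^sub>C (t q + \<i> *\<^sub>C JC q (t q))"
  have "?s \<in> csections E (cfibre E)"
    by (intro csections_on_cscale_const csections_on_add csections_cextend t(1) open_UNIV)
  moreover have "?s q \<in> Lstar_of E J q" for q
    using eigenprojections(2)[OF csections_on_mem[OF t(1)]]
    by (simp add: cvec.subspace_scale csubspace_Lstar_of)
  ultimately have "?s \<in> csections E (Lstar_of E J)" by (rule csections_onI)
  moreover have "?s p = u"
    by (simp add: t(2) Lstar_ofD(2)[OF assms] cscale_def prod_eq_iff flip: scaleR_left_distrib)
  ultimately show thesis by (rule that)
qed

text \<open>
  Sections of \<open>L\<^sub>J\<^sup>*\<close> are those of the form \<open>a + \<i> J a\<close> with \<open>a\<close> a real section. For two of them, the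
  statement that the bracket has this form again is the vanishing of the Nijenhuis torsion.
\<close>

lemma Lstar_closed:
  assumes "x \<in> csections E (Lstar_of E J)" "y \<in> csections E (Lstar_of E J)"
  shows "cdorfman E x y \<in> csections E (Lstar_of E J)"
proof (rule csections_onI[OF cdorfman_closed[OF assms]])
  fix p
  obtain a b where x: "x = (\<lambda>p. (a p, b p))" and ab: "a \<in> sections E" "b \<in> sections E"
    using assms(1) by (rule csection_cases)
  obtain c d where y: "y = (\<lambda>p. (c p, d p))" and cd: "c \<in> sections E" "d \<in> sections E"
    using assms(2) by (rule csection_cases)
  have b: "b = (\<lambda>p. J p (a p))" and d: "d = (\<lambda>p. J p (c p))"
    using csections_on_mem[OF assms(1)] csections_on_mem[OF assms(2)]
    by (auto simp: x y Lstar_of_def cextend_def cscale_def)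
  have fib: "s p \<in> fibre E p" if "s \<in> sections E" for s
    using section_fibre[OF that] by simp
  have "dorfman E b d p - J p (dorfman E a d p) - J p (dorfman E b c p) + J p (J p (dorfman E a c p)) = 0"
    using fun_cong[OF J_integrable[OF ab(1) cd(1)], of p] by (simp add: nijenhuis_def flip: b d)
  then have 1: "J p (dorfman E a d p + dorfman E b c p) = dorfman E b d p - dorfman E a c p"
    using ab cd by (simp add: J_square J_lin fib dorfman_closed algebra_simps)
  have f: "dorfman E a d p + dorfman E b c p \<in> fibre E p" "dorfman E b d p - dorfman E a c p \<in> fibre E p"
    using ab cd by (simp_all add: fib dorfman_closed fibre_closed)
  have "J p (dorfman E a c p - dorfman E b d p) = dorfman E a d p + dorfman E b c p"
    using J_square[OF f(1)] J_lin(3)[OF f(2,2)] unfolding 1 by simp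
  with 1 show "cdorfman E x y p \<in> Lstar_of E J p"
    using ab cd
    by (simp add: Lstar_of_def mem_cfibre x y cdorfman_pair cextend_def cscale_def fib dorfman_closed fibre_closed)
qed

end

section \<open>The musical endomorphisms of a holomorphic symplectic structure\<close>

context holomorphic_symplectic
begin

abbreviation (input) "A \<equiv> sharp E \<Omega>"
abbreviation (input) "B \<equiv> sharp E (conj_form \<Omega>)"

lemma Omega_local:
  obtains U n a b where "open U" "p \<in> U"
    "\<And>k. k < n \<Longrightarrow> a k \<in> csections_on E (L_of E J) U" "\<And>k. k < n \<Longrightarrow> b k \<in> csections_on E (L_of E J) U"
    "\<And>q u v. q \<in> U \<Longrightarrow> u \<in> cfibre E q \<Longrightarrow> v \<in> cfibre E q \<Longrightarrow>
      \<Omega> q u v = (\<Sum>k<(n::nat). wedge E q (a k q) (b k q) u v)"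
proof -
  from Omega_section have "\<exists>U n a b. open U \<and> p \<in> U \<and>
     (\<forall>k<n. a k \<in> csections_on E (L_of E J) U \<and> b k \<in> csections_on E (L_of E J) U) \<and>
     (\<forall>q\<in>U. \<forall>u\<in>cfibre E q. \<forall>v\<in>cfibre E q. \<Omega> q u v = (\<Sum>k<(n::nat). wedge E q (a k q) (b k q) u v))"
    by (simp add: wedge2_sections_def)
  then show thesis using that by blast
qed

lemma cpairing_sum:
  assumes "finite S" "\<And>k. k \<in> S \<Longrightarrow> f k \<in> cfibre E p" "v \<in> cfibre E p"
  shows "(\<Sum>k\<in>S. f k) \<in> cfibre E p \<and> cpairing E p (\<Sum>k\<in>S. f k) v = (\<Sum>k\<in>S. cpairing E p (f k) v)"
  using assms by (induction S rule: finite_induct) (auto simp: cfibre_closed cpairing_zero cpairing_lin)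

text \<open>
  Since \<open>(a \<and> b)(u, v) = \<langle>\<langle>a, u\<rangle> b - \<langle>b, u\<rangle> a, v\<rangle>\<close>, the description operator in \<^const>\<open>sharp\<close> has the value
  that the local decomposition of \<open>\<Omega>\<close> suggests.
\<close>

lemma sharp_local:
  obtains U n a b where "open U" "p \<in> U"
    "\<And>k. k < n \<Longrightarrow> a k \<in> csections_on E (L_of E J) U" "\<And>k. k < n \<Longrightarrow> b k \<in> csections_on E (L_of E J) U"
    "\<And>q u. q \<in> U \<Longrightarrow> u \<in> cfibre E q \<Longrightarrow>
      A q u = (\<Sum>k<(n::nat). cpairing E q (a k q) u *\<^sub>C b k q - cpairing E q (b k q) u *\<^sub>C a k q)"
    "\<And>q u v. q \<in> U \<Longrightarrow> u \<in> cfibre E q \<Longrightarrow> v \<in> cfibre E q \<Longrightarrow> \<Omega> q u v = cpairing E q (A q u) v"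
proof -
  obtain U n a b where U: "open U" "p \<in> U"
    and a: "\<And>k. k < n \<Longrightarrow> a k \<in> csections_on E (L_of E J) U"
    and b: "\<And>k. k < n \<Longrightarrow> b k \<in> csections_on E (L_of E J) U"
    and \<Omega>: "\<And>q u v. q \<in> U \<Longrightarrow> u \<in> cfibre E q \<Longrightarrow> v \<in> cfibre E q \<Longrightarrow>
      \<Omega> q u v = (\<Sum>k<(n::nat). wedge E q (a k q) (b k q) u v)"
    by (rule Omega_local[of p]) blast
  have *: "A q u = (\<Sum>k<n. cpairing E q (a k q) u *\<^sub>C b k q - cpairing E q (b k q) u *\<^sub>C a k q) \<and>
      (\<forall>v\<in>cfibre E q. \<Omega> q u v =
        cpairing E q (\<Sum>k<n. cpairing E q (a k q) u *\<^sub>C b k q - cpairing E q (b k q) u *\<^sub>C a k q) v)"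
    (is "A q u = ?w \<and> _") if q: "q \<in> U" and u: "u \<in> cfibre E q" for q u
  proof -
    have ab: "a k q \<in> cfibre E q" "b k q \<in> cfibre E q" if "k < n" for k
      using csections_on_mem[OF a[OF that] q] csections_on_mem[OF b[OF that] q] by (auto dest: L_ofD(1))
    have "?w \<in> cfibre E q \<and> cpairing E q ?w v =
        (\<Sum>k<n. cpairing E q (cpairing E q (a k q) u *\<^sub>C b k q - cpairing E q (b k q) u *\<^sub>C a k q) v)"
      if "v \<in> cfibre E q" for v
      by (rule cpairing_sum) (use ab that in \<open>auto intro!: cfibre_closed\<close>)
    note pair = this
    have "cpairing E q (cpairing E q (a k q) u *\<^sub>C b k q - cpairing E q (b k q) u *\<^sub>C a k q) v
        = wedge E q (a k q) (b k q) u v" if "k < n" "v \<in> cfibre E q" for k v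
      using ab[OF that(1)] that(2) u by (simp add: cpairing_lin cfibre_closed wedge_def mult.commute)
    with pair[OF cfibre_closed(1)] pair have w: "?w \<in> cfibre E q" "\<And>v. v \<in> cfibre E q \<Longrightarrow> \<Omega> q u v = cpairing E q ?w v"
      using \<Omega>[OF q u] by simp_all
    then show ?thesis using sharp_eqI[of ?w q \<Omega> u] by blast
  qed
  show thesis by (rule that[OF U a b]) (use * in auto)
qed

lemma sharp_mem: "u \<in> cfibre E p \<Longrightarrow> A p u \<in> L_of E J p"
proof (rule sharp_local[of p])
  fix U n a b
  assume U: "p \<in> U" and a: "\<And>k. k < n \<Longrightarrow> a k \<in> csections_on E (L_of E J) U"
    and b: "\<And>k. k < n \<Longrightarrow> b k \<in> csections_on E (L_of E J) U"
    and A: "\<And>q u. q \<in> U \<Longrightarrow> u \<in> cfibre E q \<Longrightarrow>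
      A q u = (\<Sum>k<(n::nat). cpairing E q (a k q) u *\<^sub>C b k q - cpairing E q (b k q) u *\<^sub>C a k q)"
    and u: "u \<in> cfibre E p"
  show "A p u \<in> L_of E J p"
    unfolding A[OF U u]
    by (intro cvec.subspace_sum cvec.subspace_diff cvec.subspace_scale csubspace_L_of)
      (use csections_on_mem[OF a U] csections_on_mem[OF b U] in auto)
qed

lemma Omega_eq_sharp: "u \<in> cfibre E p \<Longrightarrow> v \<in> cfibre E p \<Longrightarrow> \<Omega> p u v = cpairing E p (A p u) v"
  by (rule sharp_local[of p]) blast

lemma Omega_skew: "u \<in> cfibre E p \<Longrightarrow> v \<in> cfibre E p \<Longrightarrow> \<Omega> p v u = - \<Omega> p u v"
  by (rule Omega_local[of p]) (simp add: wedge_def flip: sum_negf)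

lemma sharp_cfibre: "u \<in> cfibre E p \<Longrightarrow> A p u \<in> cfibre E p"
  by (simp add: sharp_mem L_ofD(1))

lemma sharp_skew:
  assumes "u \<in> cfibre E p" "v \<in> cfibre E p"
  shows "cpairing E p (A p u) v = - cpairing E p (A p v) u"
  using Omega_skew[OF assms] Omega_eq_sharp assms by simp

lemma sharp_lin:
  assumes "u \<in> cfibre E p" "v \<in> cfibre E p"
  shows "A p (u + v) = A p u + A p v" "A p (c *\<^sub>C u) = c *\<^sub>C A p u" "A p (- u) = - A p u"
proof -
  note c = assms sharp_cfibre[OF assms(1)] sharp_cfibre[OF assms(2)]
  have *: "\<Omega> p x w = - cpairing E p (A p w) x" if "x \<in> cfibre E p" "w \<in> cfibre E p" for x w
    using Omega_eq_sharp[OF that] sharp_skew[OF that] by simp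
  show "A p (u + v) = A p u + A p v"
  proof (rule sharp_eqI)
    fix w assume w: "w \<in> cfibre E p"
    show "\<Omega> p (u + v) w = cpairing E p (A p u + A p v) w"
      using *[of "u + v" w] sharp_skew[OF assms(1) w] sharp_skew[OF assms(2) w] w c sharp_cfibre[OF w]
      by (simp add: cfibre_closed cpairing_lin)
  qed (use c in \<open>simp add: cfibre_closed\<close>)
  show scale: "A p (c *\<^sub>C u) = c *\<^sub>C A p u" for c
  proof (rule sharp_eqI)
    fix w assume w: "w \<in> cfibre E p"
    show "\<Omega> p (c *\<^sub>C u) w = cpairing E p (c *\<^sub>C A p u) w"
      using *[of "c *\<^sub>C u" w] sharp_skew[OF assms(1) w] w c sharp_cfibre[OF w]
      by (simp add: cfibre_closed cpairing_lin(3)[OF c(3) c(3)] cpairing_lin(4)[OF c(1) c(1)])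
  qed (use c in \<open>simp add: cfibre_closed\<close>)
  from scale[of "- 1"] show "A p (- u) = - A p u" by (simp only: cscale_minus_one)
qed

text \<open>
  \<open>\<langle>A u, v\<rangle> = - \<langle>A v, u\<rangle>\<close>, and both \<open>A v\<close> and \<open>u\<close> lie in the isotropic space \<open>L\<^sub>J\<close>.
\<close>

lemma sharp_L_of:
  assumes "u \<in> L_of E J p"
  shows "A p u = 0"
  by (rule sharp_eqI)
    (use assms L_ofD in \<open>auto simp: cfibre_closed cpairing_zero Omega_eq_sharp sharp_skew L_of_isotropic sharp_mem\<close>)

lemma sharp_section:
  assumes "x \<in> csections E (cfibre E)"
  shows "(\<lambda>p. A p (x p)) \<in> csections E (L_of E J)"
proof (rule csections_onI[OF csections_on_local])
  show "A p (x p) \<in> L_of E J p" for p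
    using sharp_mem csections_on_mem[OF assms] by simp
  fix p
  obtain U n a b where U: "open U" "p \<in> U"
    and ab: "\<And>k. k < n \<Longrightarrow> a k \<in> csections_on E (L_of E J) U" "\<And>k. k < n \<Longrightarrow> b k \<in> csections_on E (L_of E J) U"
    and A: "\<And>q u. q \<in> U \<Longrightarrow> u \<in> cfibre E q \<Longrightarrow>
      A q u = (\<Sum>k<(n::nat). cpairing E q (a k q) u *\<^sub>C b k q - cpairing E q (b k q) u *\<^sub>C a k q)"
    by (rule sharp_local[of p]) blast
  have x: "x \<in> csections_on E (cfibre E) U"
    using assms sections_on_subset by (auto simp: csections_on_cfibre)
  have "(\<lambda>q. \<Sum>k<n. cpairing E q (a k q) (x q) *\<^sub>C b k q - cpairing E q (b k q) (x q) *\<^sub>C a k q)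
      \<in> csections_on E (cfibre E) U"
    by (intro csections_on_sum csections_on_diff csections_on_cscale cpairing_smooth U(1) x)
      (use ab[THEN csections_on_cfibreD] in auto)
  then have "(\<lambda>q. A q (x q)) \<in> csections_on E (cfibre E) U"
    by (rule csections_on_cong) (use A csections_on_mem[OF x] in simp)
  then show "\<exists>W. open W \<and> p \<in> W \<and> (\<lambda>q. A q (x q)) \<in> csections_on E (cfibre E) W"
    using U by auto
qed

text \<open>
  All properties of \<open>B\<close> are transported from \<open>A\<close> by conjugation, which exchanges \<open>L\<^sub>J\<close> and \<open>L\<^sub>J\<^sup>*\<close>.
\<close>

lemma conj_sharp_eq:
  assumes "u \<in> cfibre E p"
  shows "B p u = conj_vec (A p (conj_vec u))"
proof (rule sharp_eqI)
  note c = cfibre_closed(6)[OF assms]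
  show "conj_vec (A p (conj_vec u)) \<in> cfibre E p"
    using c by (simp add: cfibre_closed sharp_cfibre)
  show "conj_form \<Omega> p u v = cpairing E p (conj_vec (A p (conj_vec u))) v" if "v \<in> cfibre E p" for v
    using cpairing_conj[OF sharp_cfibre[OF c] cfibre_closed(6)[OF that]] c that
    by (simp add: conj_form_def Omega_eq_sharp cfibre_closed)
qed

lemma conj_sharp_mem: "u \<in> cfibre E p \<Longrightarrow> B p u \<in> Lstar_of E J p"
  by (simp add: conj_sharp_eq conj_L_of sharp_mem cfibre_closed)

lemma conj_sharp_cfibre: "u \<in> cfibre E p \<Longrightarrow> B p u \<in> cfibre E p"
  by (simp add: conj_sharp_mem Lstar_ofD(1))

lemma conj_sharp_lin:
  assumes "u \<in> cfibre E p" "v \<in> cfibre E p"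
  shows "B p (u + v) = B p u + B p v" "B p (c *\<^sub>C u) = c *\<^sub>C B p u"
  using assms by (simp_all add: conj_sharp_eq cfibre_closed sharp_lin)

lemma conj_sharp_Lstar_of: "u \<in> Lstar_of E J p \<Longrightarrow> B p u = 0"
  by (simp add: conj_sharp_eq Lstar_ofD(1) sharp_L_of conj_Lstar_of) (simp add: conj_vec_def zero_prod_def)

lemma conj_sharp_section:
  assumes "x \<in> csections E (cfibre E)"
  shows "(\<lambda>p. B p (x p)) \<in> csections E (Lstar_of E J)"
proof (rule csections_onI)
  have "(\<lambda>p. conj_vec (A p (conj_vec (x p)))) \<in> csections E (cfibre E)"
    using assms by (intro csections_on_conj csections_on_cfibreD[OF sharp_section] open_UNIV)
  then show "(\<lambda>p. B p (x p)) \<in> csections E (cfibre E)"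
    using csections_on_mem[OF assms] by (simp add: conj_sharp_eq)
  show "B p (x p) \<in> Lstar_of E J p" for p
    using csections_on_mem[OF assms] by (simp add: conj_sharp_mem)
qed

lemma conj_sharp_sharp: "u \<in> Lstar_of E J p \<Longrightarrow> B p (A p u) = - u"
  using Omega_sharp[of u p] sharp_L_of[OF cvec.subspace_0[OF csubspace_L_of]]
  by (simp add: Lstar_ofD(1) conj_sharp_Lstar_of)

text \<open>
  \<open>B\<close> sees only the \<open>L\<^sub>J\<close>-component of \<open>u\<close>, on which \<open>J\<close> is multiplication with \<open>\<i>\<close>.
\<close>

lemma conj_sharp_cextend:
  assumes "u \<in> cfibre E p"
  shows "B p (JC p u) = \<i> *\<^sub>C B p u"
proof -
  note c = assms cextend_closed[OF assms]
  have "B p (u + \<i> *\<^sub>C JC p u) = 0" by (rule conj_sharp_Lstar_of[OF eigenprojections(2)[OF assms]])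
  then have "B p u + \<i> *\<^sub>C B p (JC p u) = 0"
    using c by (simp add: conj_sharp_lin cfibre_closed)
  then have "\<i> *\<^sub>C (B p u + \<i> *\<^sub>C B p (JC p u)) = 0" by simp
  then show ?thesis by (simp add: cvec.scale_right_distrib eq_neg_iff_add_eq_0 algebra_simps)
qed

lemma sharp_conj_sharp_pairing:
  assumes "u \<in> cfibre E p" "w \<in> Lstar_of E J p"
  shows "cpairing E p (A p (B p u)) w = - cpairing E p u w"
proof -
  note w = Lstar_ofD(1)[OF assms(2)]
  have c: "A p (B p u) \<in> cfibre E p" "B p (A p u) \<in> cfibre E p"
    using assms(1) by (simp_all add: sharp_cfibre conj_sharp_cfibre)
  have "cpairing E p (A p (B p u) + B p (A p u)) w = - cpairing E p u w"
    unfolding Omega_sharp[OF assms(1)] by (rule cpairing_lin(5)[OF assms(1) assms(1) w])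
  moreover have "cpairing E p (B p (A p u)) w = 0"
    using assms by (simp add: Lstar_of_isotropic conj_sharp_mem sharp_cfibre)
  ultimately show ?thesis using c w by (simp add: cpairing_lin)
qed

lemma Omega_lin:
  assumes "u \<in> cfibre E p" "v \<in> cfibre E p" "w \<in> cfibre E p"
  shows "\<Omega> p w (u + v) = \<Omega> p w u + \<Omega> p w v" "\<Omega> p w (c *\<^sub>C u) = c * \<Omega> p w u"
    "\<Omega> p (u + v) w = \<Omega> p u w + \<Omega> p v w" "\<Omega> p (c *\<^sub>C u) w = c * \<Omega> p u w"
proof -
  note Aw = sharp_cfibre[OF assms(3)]
  show r: "\<Omega> p w (u + v) = \<Omega> p w u + \<Omega> p w v" "\<Omega> p w (c *\<^sub>C u) = c * \<Omega> p w u"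
    unfolding Omega_eq_sharp[OF assms(3) assms(1)] Omega_eq_sharp[OF assms(3) assms(2)]
      Omega_eq_sharp[OF assms(3) cfibre_closed(2)[OF assms(1,2)]]
      Omega_eq_sharp[OF assms(3) cfibre_closed(3)[OF assms(1)]]
    by (rule cpairing_lin[OF assms(1,2) Aw])+
  show "\<Omega> p (u + v) w = \<Omega> p u w + \<Omega> p v w" "\<Omega> p (c *\<^sub>C u) w = c * \<Omega> p u w"
    using r Omega_skew[OF assms(3) assms(1)] Omega_skew[OF assms(3) assms(2)]
      Omega_skew[OF assms(3) cfibre_closed(2)[OF assms(1,2)]] Omega_skew[OF assms(3) cfibre_closed(3)[OF assms(1)]]
    by simp_all
qed

text \<open>
  As \<open>A\<close> is injective on \<open>L\<^sub>J\<^sup>*\<close>, the restriction of \<open>\<Omega>\<close> to \<open>L\<^sub>J\<^sup>*\<close> is nondegenerate.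
\<close>

lemma Lstar_eq_0I:
  assumes t: "t \<in> Lstar_of E J p" and *: "\<And>w. w \<in> Lstar_of E J p \<Longrightarrow> cpairing E p (A p t) w = 0"
  shows "t = 0"
proof -
  note c = sharp_mem[OF Lstar_ofD(1)[OF t]]
  have "A p t = 0"
  proof (rule cpairing_nondegenerate[OF L_ofD(1)[OF c]])
    fix v assume "v \<in> cfibre E p"
    then obtain a b where v: "a \<in> L_of E J p" "b \<in> Lstar_of E J p" "v = a + b" by (rule eigenbundle_decomposition)
    then show "cpairing E p (A p t) v = 0"
      using cpairing_lin(2)[OF L_ofD(1)[OF v(1)] Lstar_ofD(1)[OF v(2)] L_ofD(1)[OF c]]
        L_of_isotropic[OF c v(1)] *[OF v(2)] by simp
  qed
  moreover have "B p 0 = 0"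
    by (rule conj_sharp_Lstar_of) (rule cvec.subspace_0[OF csubspace_Lstar_of])
  ultimately show ?thesis using conj_sharp_sharp[OF t] by simp
qed

section \<open>The hypercomplex connection on the conjugate eigenbundle\<close>

text \<open>
  On sections of \<open>L\<^sub>J\<^sup>*\<close>, \<open>J\<close> is \<open>- \<i>\<close> and \<open>I\<close> is \<open>A\<close>. With \<open>w = V \<circ> A U\<close> and \<open>t = V \<circ> U\<close>, the bracketed
  expression becomes \<open>y = - \<i> (w - \<i> J w) + 2 \<i> A t\<close>. It lies in \<open>L\<^sub>J\<close>, where \<open>A\<close> vanishes and
  \<open>K = \<i> B\<close>; so it remains to compute \<open>B y = - 2 \<i> (B w + t)\<close>.
\<close>

lemma hypercomplex_connection_Lstar:
  assumes U: "U \<in> csections E (Lstar_of E J)" and V: "V \<in> csections E (Lstar_of E J)"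
  shows "hypercomplex_connection E (\<lambda>p u. A p u + B p u) JC (\<lambda>p u. (- \<i>) *\<^sub>C (A p u - B p u)) U V =
    (\<lambda>p. - B p (cdorfman E V (\<lambda>q. A q (U q)) p) - cdorfman E V U p)"
proof
  fix p
  have AU: "(\<lambda>q. A q (U q)) \<in> csections E (L_of E J)"
    by (intro sharp_section csections_on_cfibreD[OF U])
  define w where "w = cdorfman E V (\<lambda>q. A q (U q)) p"
  define t where "t = cdorfman E V U p"
  have w: "w \<in> cfibre E p"
    unfolding w_def by (rule csections_on_mem[OF cdorfman_closed[OF V AU]]) simp
  have t: "t \<in> Lstar_of E J p"
    unfolding t_def by (rule csections_on_mem[OF Lstar_closed[OF V U]]) simp
  note tc = Lstar_ofD(1)[OF t]
  note At = sharp_mem[OF tc]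
  note Atc = L_ofD(1)[OF At]
  have BU: "B q (U q) = 0" for q
    using csections_on_mem[OF U] by (simp add: conj_sharp_Lstar_of)
  have JV: "JC q (V q) = (- \<i>) *\<^sub>C V q" for q
    using csections_on_mem[OF V] Lstar_ofD(2) by simp
  have Jt: "(- \<i>) *\<^sub>C t \<in> Lstar_of E J p"
    by (rule cvec.subspace_scale[OF csubspace_Lstar_of t])
  define y where "y = (- \<i>) *\<^sub>C (w - \<i> *\<^sub>C JC p w) + (2 * \<i>) *\<^sub>C A p t"
  have "y \<in> L_of E J p"
    unfolding y_def by (intro cvec.subspace_add cvec.subspace_scale csubspace_L_of eigenprojections w At)
  then have Ay: "A p y = 0" by (rule sharp_L_of)
  have y: "y = (- \<i>) *\<^sub>C w - JC p w + (2 * \<i>) *\<^sub>C A p t"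
    by (simp add: y_def prod_eq_iff cscale_def)
  have By: "B p y = (- 2 * \<i>) *\<^sub>C (B p w + t)"
  proof -
    have "B p y = (- \<i>) *\<^sub>C B p w + (- 1) *\<^sub>C B p (JC p w) + (2 * \<i>) *\<^sub>C B p (A p t)"
    proof -
      have "y = ((- \<i>) *\<^sub>C w + (- 1) *\<^sub>C JC p w) + (2 * \<i>) *\<^sub>C A p t"
        by (simp add: y cscale_minus_one)
      then show ?thesis
        using conj_sharp_lin[where p = p] w cextend_closed[OF w] Atc by (simp only: cfibre_closed)
    qed
    then show ?thesis
      by (simp add: conj_sharp_cextend[OF w] conj_sharp_sharp[OF t])
        (simp add: prod_eq_iff cscale_def scaleR_right_distrib scaleR_2)
  qed
  have "hypercomplex_connection E (\<lambda>p u. A p u + B p u) JC (\<lambda>p u. (- \<i>) *\<^sub>C (A p u - B p u)) U V p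
    = - (1/2) *\<^sub>R ((- \<i>) *\<^sub>C (A p y - B p y))"
  proof -
    have e1: "cdorfman E (\<lambda>q. (- \<i>) *\<^sub>C V q) (\<lambda>q. A q (U q)) p = (- \<i>) *\<^sub>C w"
      unfolding w_def by (subst cdorfman_cscale_left[OF V AU]) (rule refl)
    have e2: "cdorfman E (\<lambda>q. (- \<i>) *\<^sub>C V q) U p = (- \<i>) *\<^sub>C t"
      unfolding t_def by (subst cdorfman_cscale_left[OF V U]) (rule refl)
    have e3: "A p ((- \<i>) *\<^sub>C t) = (- \<i>) *\<^sub>C A p t" by (rule sharp_lin(2)[OF tc tc])
    have "cdorfman E (\<lambda>q. JC q (V q)) (\<lambda>q. A q (U q) + B q (U q)) p
        - JC p (cdorfman E V (\<lambda>q. A q (U q) + B q (U q)) p)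
        - (A p (cdorfman E (\<lambda>q. JC q (V q)) U p) + B p (cdorfman E (\<lambda>q. JC q (V q)) U p))
        + JC p (A p (cdorfman E V U p) + B p (cdorfman E V U p)) = y"
      unfolding y JV BU add_0_right e1 e2 e3 w_def[symmetric] t_def[symmetric]
        conj_sharp_Lstar_of[OF t] conj_sharp_Lstar_of[OF Jt] L_ofD(2)[OF At]
      by (simp add: prod_eq_iff cscale_def scaleR_2)
    then show ?thesis unfolding hypercomplex_connection_def by (simp only:)
  qed
  also have "\<dots> = - B p w - t"
    by (simp add: Ay By) (simp add: prod_eq_iff cscale_def)
  finally show "hypercomplex_connection E (\<lambda>p u. A p u + B p u) JC (\<lambda>p u. (- \<i>) *\<^sub>C (A p u - B p u)) U V p =
    - B p (cdorfman E V (\<lambda>q. A q (U q)) p) - cdorfman E V U p"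
    by (simp add: w_def t_def)
qed

text \<open>
  Let \<open>t\<close> be the difference of the two sides. By nondegeneracy it suffices that \<open>\<Omega>(t, W) = 0\<close> for all
  sections \<open>W\<close> of \<open>L\<^sub>J\<^sup>*\<close>. Because \<open>\<langle>A B u, W\<rangle> = - \<langle>u, W\<rangle>\<close> and \<open>\<circ>\<close> preserves the pairing, \<open>\<Omega>(t, W)\<close> is a
  combination of derivatives of \<open>\<Omega>\<close> and values of \<open>\<Omega>\<close> on brackets, namely \<open>d\<Omega>(x, y, W)\<close> up to the term
  \<open>\<rho>(W) \<Omega>(x, y)\<close>, and the latter vanishes by hypothesis.
\<close>

lemma sharp_connection_symmetric:
  assumes x: "x \<in> csections E (Lstar_of E J)" and y: "y \<in> csections E (Lstar_of E J)"
    and xy: "\<And>q. \<Omega> q (x q) (y q) = 0"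
  shows "- B p (cdorfman E y (\<lambda>q. A q (x q)) p) - cdorfman E y x p = - B p (cdorfman E x (\<lambda>q. A q (y q)) p)"
proof -
  have Ax: "(\<lambda>q. A q (x q)) \<in> csections E (L_of E J)" and Ay: "(\<lambda>q. A q (y q)) \<in> csections E (L_of E J)"
    using x y by (auto intro: sharp_section dest: csections_on_cfibreD)
  define a where "a = cdorfman E y (\<lambda>q. A q (x q)) p"
  define b where "b = cdorfman E x (\<lambda>q. A q (y q)) p"
  define t where "t = cdorfman E y x p + B p a - B p b"
  have mem: "s p \<in> Lstar_of E J p" if "s \<in> csections E (Lstar_of E J)" for s p
    using csections_on_mem[OF that] by simp
  have fib: "s p \<in> cfibre E p" if "s \<in> csections E (Lstar_of E J)" for s p
    using Lstar_ofD(1)[OF mem[OF that]] .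
  have ab: "a \<in> cfibre E p" "b \<in> cfibre E p"
    unfolding a_def b_def
    using csections_on_mem[OF cdorfman_closed[OF y Ax]] csections_on_mem[OF cdorfman_closed[OF x Ay]] by auto
  note c = fib[OF Lstar_closed[OF y x], of p] ab conj_sharp_cfibre[OF ab(1)] conj_sharp_cfibre[OF ab(2)]
  have t: "t \<in> Lstar_of E J p"
    unfolding t_def
    by (intro cvec.subspace_add cvec.subspace_diff csubspace_Lstar_of conj_sharp_mem ab mem Lstar_closed x y)
  have skew: "cdorfman E y x p = - cdorfman E x y p"
    using cdorfman_skew[OF x y] Lstar_of_isotropic mem[OF x] mem[OF y] by simp
  have "cpairing E p (A p t) w = 0" if w: "w \<in> Lstar_of E J p" for w
  proof -
    obtain W where W: "W \<in> csections E (Lstar_of E J)" "W p = w"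
      using Lstar_section_through[OF w] .
    have Om: "(\<lambda>q. \<Omega> q (s q) (W q)) = (\<lambda>q. cpairing E q (A q (s q)) (W q))"
      if "s \<in> csections E (Lstar_of E J)" for s
      using fib[OF that] fib[OF W(1)] by (simp add: Omega_eq_sharp)
    \<comment> \<open>the terms of \<open>d\<Omega>(x, y, W)\<close>, with the derivatives expanded by \<open>cdorfman_pairing\<close>\<close>
    have 1: "canchor_der E x (\<lambda>q. \<Omega> q (y q) (W q)) p = cpairing E p b w + \<Omega> p (y p) (cdorfman E x W p)"
      unfolding Om[OF y] cdorfman_pairing[OF x Ay W(1)]
      using fib[OF y] fib[OF Lstar_closed[OF x W(1)]] by (simp add: b_def W(2) Omega_eq_sharp)
    have 2: "canchor_der E y (\<lambda>q. \<Omega> q (x q) (W q)) p = cpairing E p a w + \<Omega> p (x p) (cdorfman E y W p)"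
      unfolding Om[OF x] cdorfman_pairing[OF y Ax W(1)]
      using fib[OF x] fib[OF Lstar_closed[OF y W(1)]] by (simp add: a_def W(2) Omega_eq_sharp)
    have 3: "canchor E p w (\<lambda>q. \<Omega> q (x q) (y q)) = 0"
      unfolding xy by (rule canchor_const[OF Lstar_ofD(1)[OF w]])
    have 4: "\<Omega> p (cdorfman E x W p) (y p) = - \<Omega> p (y p) (cdorfman E x W p)"
      "\<Omega> p (cdorfman E y W p) (x p) = - \<Omega> p (x p) (cdorfman E y W p)"
      by (intro Omega_skew fib x y Lstar_closed W(1))+
    have "\<Omega> p (cdorfman E x y p) w = cpairing E p b w - cpairing E p a w"
      using fun_cong[OF Omega_closed[OF x y W(1)], of p] unfolding d_form2_def 1 2 4 W(2) 3 by algebra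
    moreover have "cpairing E p (A p (cdorfman E y x p)) w = - \<Omega> p (cdorfman E x y p) w"
    proof -
      have f: "cdorfman E x y p \<in> cfibre E p" "w \<in> cfibre E p"
        by (rule fib[OF Lstar_closed[OF x y]], rule Lstar_ofD(1)[OF w])
      show ?thesis
        using sharp_lin(3)[OF f(1) f(1)] cpairing_lin(5)[OF sharp_cfibre[OF f(1)] f(1) f(2)] Omega_eq_sharp[OF f] by (simp add: skew)
    qed
    moreover have "cpairing E p (A p t) w =
        cpairing E p (A p (cdorfman E y x p)) w + cpairing E p (A p (B p a)) w - cpairing E p (A p (B p b)) w"
    proof -
      have "t = (cdorfman E y x p + B p a) + (- 1) *\<^sub>C B p b" by (simp add: t_def cscale_minus_one)
      then have "A p t = (A p (cdorfman E y x p) + A p (B p a)) + (- 1) *\<^sub>C A p (B p b)"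
        using c by (simp only: sharp_lin[where p = p] cfibre_closed)
      then have "A p t = (A p (cdorfman E y x p) + A p (B p a)) - A p (B p b)"
        by (simp add: cscale_minus_one)
      then show ?thesis
        using c Lstar_ofD(1)[OF w] by (simp add: cpairing_lin cfibre_closed sharp_cfibre)
    qed
    ultimately show ?thesis
      using sharp_conj_sharp_pairing[OF ab(1) w] sharp_conj_sharp_pairing[OF ab(2) w] by simp
  qed
  then have "t = 0" by (rule Lstar_eq_0I[OF t])
  then show ?thesis unfolding t_def a_def b_def by (simp add: algebra_simps)
qed

end

section \<open>Lagrangian subalgebroids\<close>

locale lagrangian_subalgebroid = holomorphic_symplectic E J \<Omega>
  for E :: "('m::{second_countable_topology, t2_space}, 'c::real_inner, 'v::real_vector, 'z) courant_scheme"
    and J \<Omega> +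
  fixes L :: "'m \<Rightarrow> ('v \<times> 'v) set"
  assumes lie_subalgebroid: "lie_subalgebroid E (Lstar_of E J) L"
    and lagrangian: "lagrangian \<Omega> (Lstar_of E J) L"
begin

lemma L_subspace: "csubspace (L p)" and L_subset: "L p \<subseteq> Lstar_of E J p"
  using lie_subalgebroid by (auto simp: lie_subalgebroid_def csubbundle_def)

lemma L_closed: "x \<in> csections E L \<Longrightarrow> y \<in> csections E L \<Longrightarrow> cdorfman E x y \<in> csections E L"
  using lie_subalgebroid by (auto simp: lie_subalgebroid_def)

lemma L_isotropic: "u \<in> L p \<Longrightarrow> v \<in> L p \<Longrightarrow> \<Omega> p u v = 0"
  using lagrangian by (auto simp: lagrangian_def isotropic_def)

lemma csections_L_Lstar: "x \<in> csections E L \<Longrightarrow> x \<in> csections E (Lstar_of E J)"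
  using L_subset by (auto simp: csections_on_def)

lemma L_cfibre: "x \<in> csections E L \<Longrightarrow> x p \<in> cfibre E p"
  by (rule csections_on_mem[OF csections_on_cfibreD UNIV_I])

lemma L_section_through:
  assumes "w \<in> L p"
  obtains s where "s \<in> csections E L" "s p = w"
proof -
  obtain U r e where U: "open U" "p \<in> U" and e: "\<And>i. i < (r::nat) \<Longrightarrow> e i \<in> csections_on E L U"
    and inj: "inj_on (\<lambda>i. e i p) {..<r}" and span: "cspan ((\<lambda>i. e i p) ` {..<r}) = L p"
    using lie_subalgebroid unfolding lie_subalgebroid_def csubbundle_def by metis
  have "w \<in> cspan ((\<lambda>i. e i p) ` {..<r})" using assms span by simp
  then obtain c where c: "w = (\<Sum>i<r. c (e i p) *\<^sub>C e i p)"
    using inj by (auto simp: cvec.span_finite sum.reindex)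
  have "(\<lambda>q. \<Sum>i<r. c (e i p) *\<^sub>C e i q) \<in> csections_on E L U"
  proof (rule csections_onI)
    show "(\<lambda>q. \<Sum>i<r. c (e i p) *\<^sub>C e i q) \<in> csections_on E (cfibre E) U"
      using U(1) e[THEN csections_on_cfibreD] by (intro csections_on_sum csections_on_cscale_const) auto
    show "(\<Sum>i<r. c (e i p) *\<^sub>C e i q) \<in> L q" if "q \<in> U" for q
      using csections_on_mem[OF e that] by (intro cvec.subspace_sum cvec.subspace_scale L_subspace) auto
  qed
  then obtain s where "s \<in> csections E L" "s p = (\<Sum>i<r. c (e i p) *\<^sub>C e i p)"
    using csection_extension[where B = L, OF U _ L_subspace] by blast
  then show thesis using that c by simp
qed

text \<open>
  Otherwise \<open>L p + \<complex> t\<close> would be a larger isotropic subspace, since \<open>\<Omega>(t, t) = 0\<close>.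
\<close>

lemma L_maximal:
  assumes t: "t \<in> Lstar_of E J p" and orth: "\<And>w. w \<in> L p \<Longrightarrow> \<Omega> p t w = 0"
  shows "t \<in> L p"
proof -
  let ?W = "cspan (insert t (L p))"
  have span: "cspan (L p) = L p" using L_subspace by (simp add: cvec.span_eq_iff)
  have W: "\<exists>c l. l \<in> L p \<and> u = l + c *\<^sub>C t" if "u \<in> ?W" for u
  proof -
    have "\<exists>c. u - c *\<^sub>C t \<in> cspan (L p)"
      using that cvec.span_breakdown_eq[of u t "L p"] by simp
    then obtain c where "u - c *\<^sub>C t \<in> L p"
      unfolding span ..
    then show ?thesis by (intro exI[of _ c] exI[of _ "u - c *\<^sub>C t"]) simp
  qed
  have sub: "?W \<subseteq> Lstar_of E J p"
    by (rule cvec.span_minimal) (use t L_subset csubspace_Lstar_of in auto)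
  have cf: "l \<in> cfibre E p" if "l \<in> L p" for l
    by (rule Lstar_ofD(1)[OF subsetD[OF L_subset that]])
  note tc = Lstar_ofD(1)[OF t]
  have "\<Omega> p u v = 0" if uv: "u \<in> ?W" "v \<in> ?W" for u v
  proof -
    obtain l c where u: "l \<in> L p" "u = l + c *\<^sub>C t" using W[OF uv(1)] by blast
    obtain m d where v: "m \<in> L p" "v = m + d *\<^sub>C t" using W[OF uv(2)] by blast
    note f = cf[OF u(1)] cf[OF v(1)] tc
    note s = cfibre_closed(3)[OF tc, of c] cfibre_closed(3)[OF tc, of d]
    have tt: "\<Omega> p t t = 0"
      using Omega_skew[OF tc tc] by simp
    have lt: "\<Omega> p l t = 0"
      using Omega_skew[OF tc f(1)] orth[OF u(1)] by simp
    have "\<Omega> p u v = \<Omega> p l m + d * \<Omega> p l t + c * (\<Omega> p t m + d * \<Omega> p t t)"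
      unfolding u(2) v(2) Omega_lin(3)[OF f(1) s(1) cfibre_closed(2)[OF f(2) s(2)]]
        Omega_lin(4)[OF tc tc cfibre_closed(2)[OF f(2) s(2)]] Omega_lin(1)[OF f(2) s(2) f(1)]
        Omega_lin(1)[OF f(2) s(2) tc] Omega_lin(2)[OF tc tc f(1)] Omega_lin(2)[OF tc tc tc] ..
    then show ?thesis
      using tt lt orth[OF v(1)] L_isotropic[OF u(1) v(1)] by simp
  qed
  then have "isotropic (\<Omega> p) ?W" by (simp add: isotropic_def)
  moreover have "L p \<subseteq> ?W" using cvec.span_superset[of "insert t (L p)"] by simp
  ultimately have "?W = L p"
    using lagrangian[unfolded lagrangian_def, THEN spec[of _ p], THEN conjunct2, THEN spec[of _ ?W]]
      cvec.subspace_span sub by simp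
  then show ?thesis using cvec.span_base[of t "insert t (L p)"] by simp
qed

section \<open>The induced connection\<close>

definition nabla :: "('m \<Rightarrow> 'v \<times> 'v) \<Rightarrow> ('m \<Rightarrow> 'v \<times> 'v) \<Rightarrow> ('m \<Rightarrow> 'v \<times> 'v)" where
  "nabla = hypercomplex_connection E (\<lambda>p u. A p u + B p u) JC (\<lambda>p u. (- \<i>) *\<^sub>C (A p u - B p u))"

lemma nabla_Lstar:
  assumes "x \<in> csections E (Lstar_of E J)" "y \<in> csections E (Lstar_of E J)"
  shows "nabla x y = (\<lambda>p. - B p (cdorfman E y (\<lambda>q. A q (x q)) p) - cdorfman E y x p)"
  unfolding nabla_def by (rule hypercomplex_connection_Lstar[OF assms])

lemma nabla_eq:
  assumes "x \<in> csections E L" "y \<in> csections E L"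
  shows "nabla x y = (\<lambda>p. - B p (cdorfman E x (\<lambda>q. A q (y q)) p))"
proof -
  note s = assms[THEN csections_L_Lstar]
  have "\<Omega> q (x q) (y q) = 0" for q
    using csections_on_mem[OF assms(1)] csections_on_mem[OF assms(2)] by (simp add: L_isotropic)
  then show ?thesis
    unfolding nabla_Lstar[OF s] by (simp add: sharp_connection_symmetric[OF s])
qed

lemma sharp_L_section: "x \<in> csections E L \<Longrightarrow> (\<lambda>q. A q (x q)) \<in> csections E (L_of E J)"
  by (intro sharp_section csections_on_cfibreD)

lemma dorfman_skew_L:
  assumes "x \<in> csections E L" "y \<in> csections E L"
  shows "cdorfman E y x p = - cdorfman E x y p"
  using assms[THEN csections_L_Lstar, THEN csections_on_mem]
  by (simp add: cdorfman_skew[OF assms] Lstar_of_isotropic)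

text \<open>
  Apply the expression from \<open>nabla_Lstar\<close> to \<open>\<nabla>\<^sub>x y\<close> and the one from \<open>nabla_eq\<close> to \<open>\<nabla>\<^sub>y x\<close>: the terms
  \<open>B (y \<circ> A x)\<close> cancel.
\<close>

lemma nabla_torsion:
  assumes "x \<in> csections E L" "y \<in> csections E L"
  shows "nabla x y p - nabla y x p = cdorfman E x y p"
  unfolding nabla_Lstar[OF assms[THEN csections_L_Lstar]] nabla_eq[OF assms(2,1)]
  by (simp add: dorfman_skew_L[OF assms])

lemma nabla_closed:
  assumes x: "x \<in> csections E L" and y: "y \<in> csections E L"
  shows "nabla x y \<in> csections E L"
proof -
  note Ay = sharp_L_section[OF y]
  let ?D = "\<lambda>p. - B p (cdorfman E x (\<lambda>q. A q (y q)) p)"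
  have B: "(\<lambda>p. B p (cdorfman E x (\<lambda>q. A q (y q)) p)) \<in> csections E (Lstar_of E J)"
    by (rule conj_sharp_section[OF cdorfman_closed[OF x Ay]])
  have "?D p \<in> L p" for p
  proof (rule L_maximal)
    let ?b = "cdorfman E x (\<lambda>q. A q (y q)) p"
    have b: "?b \<in> cfibre E p" by (rule csections_on_mem[OF cdorfman_closed[OF x Ay] UNIV_I])
    have Bb: "B p ?b \<in> Lstar_of E J p" by (rule conj_sharp_mem[OF b])
    show D: "?D p \<in> Lstar_of E J p" by (rule cvec.subspace_neg[OF csubspace_Lstar_of Bb])
    fix w assume w: "w \<in> L p"
    then have w': "w \<in> Lstar_of E J p" using L_subset by blast
    note wc = Lstar_ofD(1)[OF w']
    obtain W where W: "W \<in> csections E L" "W p = w" using L_section_through[OF w] .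
    have 0: "cpairing E q (A q (y q)) (s q) = 0" if "s \<in> csections E L" for s q
      using L_isotropic[OF csections_on_mem[OF y UNIV_I] csections_on_mem[OF that UNIV_I]]
      unfolding Omega_eq_sharp[OF L_cfibre[OF y] L_cfibre[OF that]] .
    have "cpairing E p ?b w = 0"
      using cdorfman_pairing[OF x Ay W(1), of p]
      unfolding 0[OF W(1)] 0[OF L_closed[OF x W(1)]] canchor_const[OF L_cfibre[OF x]] W(2) by simp
    moreover have "\<Omega> p (- B p ?b) w = - cpairing E p (A p (B p ?b)) w"
    proof -
      note Bc = Lstar_ofD(1)[OF Bb]
      show ?thesis
        using sharp_lin(3)[OF Bc Bc] Omega_eq_sharp[OF Lstar_ofD(1)[OF D] wc] cpairing_lin(5)[OF sharp_cfibre[OF Bc] Bc wc] by simp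
    qed
    ultimately show "\<Omega> p (?D p) w = 0"
      using sharp_conj_sharp_pairing[OF b w'] by simp
  qed
  then show ?thesis
    unfolding nabla_eq[OF x y]
    by (rule csections_onI[OF csections_on_minus[OF open_UNIV csections_on_cfibreD[OF B]]])
qed

lemma csections_L_add:
  assumes "x \<in> csections E L" "y \<in> csections E L"
  shows "(\<lambda>p. x p + y p) \<in> csections E L"
  using csections_on_add[OF open_UNIV assms[THEN csections_on_cfibreD]]
    cvec.subspace_add[OF L_subspace assms[THEN csections_on_mem[OF _ UNIV_I]]]
  by (rule csections_onI)

lemma csections_L_cscale:
  assumes "f \<in> smooth_funs E" "x \<in> csections E L"
  shows "(\<lambda>p. f p *\<^sub>C x p) \<in> csections E L"
proof (rule csections_onI)
  show "(\<lambda>p. f p *\<^sub>C x p) \<in> csections E (cfibre E)"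
    using assms(1) by (intro csections_on_cscale open_UNIV csections_on_cfibreD[OF assms(2)]) (simp add: smooth_funs_def)
  show "f p *\<^sub>C x p \<in> L p" for p
    using csections_on_mem[OF assms(2)] by (simp add: cvec.subspace_scale L_subspace)
qed

lemma cdorfman_sharp_cfibre:
  "x \<in> csections E L \<Longrightarrow> y \<in> csections E L \<Longrightarrow> cdorfman E x (\<lambda>q. A q (y q)) p \<in> cfibre E p"
  using csections_on_mem[OF cdorfman_closed[OF _ sharp_L_section]] by blast

lemma nabla_add_left:
  assumes "x \<in> csections E L" "y \<in> csections E L" "v \<in> csections E L"
  shows "nabla (\<lambda>p. x p + y p) v = (\<lambda>p. nabla x v p + nabla y v p)"
  unfolding nabla_eq[OF csections_L_add[OF assms(1,2)] assms(3)] nabla_eq[OF assms(1,3)] nabla_eq[OF assms(2,3)]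
  by (simp add: cdorfman_add_left[OF assms(1,2) sharp_L_section[OF assms(3)]] conj_sharp_lin
      cdorfman_sharp_cfibre assms)

lemma nabla_add_right:
  assumes "x \<in> csections E L" "v \<in> csections E L" "w \<in> csections E L"
  shows "nabla x (\<lambda>p. v p + w p) = (\<lambda>p. nabla x v p + nabla x w p)"
proof -
  have "(\<lambda>q. A q (v q + w q)) = (\<lambda>q. A q (v q) + A q (w q))"
    using assms L_cfibre by (simp add: sharp_lin)
  then show ?thesis
    unfolding nabla_eq[OF assms(1) csections_L_add[OF assms(2,3)]] nabla_eq[OF assms(1,2)] nabla_eq[OF assms(1,3)]
    by (simp add: cdorfman_add_right[OF assms(1) assms(2,3)[THEN sharp_L_section]] conj_sharp_lin
        cdorfman_sharp_cfibre assms)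
qed

lemma nabla_leibniz:
  assumes f: "f \<in> smooth_funs E" and x: "x \<in> csections E L" and v: "v \<in> csections E L"
  shows "nabla x (\<lambda>p. f p *\<^sub>C v p) = (\<lambda>p. f p *\<^sub>C nabla x v p + canchor_der E x f p *\<^sub>C v p)"
proof
  fix p
  note c = cdorfman_sharp_cfibre[OF x v, of p] and vc = L_cfibre[OF v]
  have "(\<lambda>q. A q (f q *\<^sub>C v q)) = (\<lambda>q. f q *\<^sub>C A q (v q))"
    using sharp_lin(2)[OF vc vc] by simp
  then have "nabla x (\<lambda>p. f p *\<^sub>C v p) p =
      - B p (canchor E p (x p) f *\<^sub>C A p (v p) + f p *\<^sub>C cdorfman E x (\<lambda>q. A q (v q)) p)"
    unfolding nabla_eq[OF x csections_L_cscale[OF f v]] by (simp add: cdorfman_leibniz[OF x sharp_L_section[OF v] f])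
  also have "\<dots> = - (canchor E p (x p) f *\<^sub>C B p (A p (v p)) + f p *\<^sub>C B p (cdorfman E x (\<lambda>q. A q (v q)) p))"
    using c sharp_cfibre[OF vc] by (simp add: conj_sharp_lin(1) conj_sharp_lin(2)[OF c c]
        conj_sharp_lin(2)[OF sharp_cfibre[OF vc] sharp_cfibre[OF vc]] cfibre_closed)
  also have "B p (A p (v p)) = - v p"
    using csections_on_mem[OF csections_L_Lstar[OF v]] by (simp add: conj_sharp_sharp)
  finally show "nabla x (\<lambda>p. f p *\<^sub>C v p) p = f p *\<^sub>C nabla x v p + canchor_der E x f p *\<^sub>C v p"
    by (simp add: nabla_eq[OF x v] cvec.scale_minus_right)
qed

text \<open>
  The right Leibniz rules suffice: \<open>\<nabla>\<^bsub>f x\<^esub> v = \<nabla>\<^sub>v (f x) - v \<circ> f x\<close>, where the derivatives of \<open>f\<close> cancel.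
\<close>

lemma nabla_tensorial:
  assumes f: "f \<in> smooth_funs E" and x: "x \<in> csections E L" and v: "v \<in> csections E L"
  shows "nabla (\<lambda>p. f p *\<^sub>C x p) v = (\<lambda>p. f p *\<^sub>C nabla x v p)"
proof
  fix p
  note fx = csections_L_cscale[OF f x]
  have "nabla (\<lambda>p. f p *\<^sub>C x p) v p = nabla v (\<lambda>p. f p *\<^sub>C x p) p - cdorfman E v (\<lambda>p. f p *\<^sub>C x p) p"
    using nabla_torsion[OF v fx, of p] by (simp add: algebra_simps)
  also have "\<dots> = f p *\<^sub>C (nabla v x p - cdorfman E v x p)"
    by (simp add: nabla_leibniz[OF f v x] cdorfman_leibniz[OF v x f] cvec.scale_right_diff_distrib)
  also have "nabla v x p - cdorfman E v x p = nabla x v p"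
    using nabla_torsion[OF v x, of p] by (simp add: algebra_simps)
  finally show "nabla (\<lambda>p. f p *\<^sub>C x p) v p = f p *\<^sub>C nabla x v p" .
qed

lemma nabla_cscale_right:
  assumes "x \<in> csections E L" "v \<in> csections E L"
  shows "nabla x (\<lambda>p. a *\<^sub>C v p) = (\<lambda>p. a *\<^sub>C nabla x v p)"
  using nabla_leibniz[OF const_smooth assms, of a] by (simp add: canchor_const L_cfibre[OF assms(1)])

lemma nabla_connection: "algebroid_connection E L L nabla"
  unfolding algebroid_connection_def
  by (intro conjI ballI allI nabla_closed nabla_add_left nabla_add_right nabla_cscale_right nabla_leibniz
      nabla_tensorial nabla_tensorial[OF const_smooth])

lemma nabla_torsion_free: "torsion_free E L nabla"
  unfolding torsion_free_def by (simp add: nabla_torsion)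

text \<open>
  Taking \<open>A\<close> of \<open>\<nabla>\<^sub>y z\<close> replaces \<open>y \<circ> A z\<close> by its \<open>L\<^sub>J\<close>-component. The omitted component lies in \<open>L\<^sub>J\<^sup>*\<close>;
  bracketing it with \<open>x\<close> stays in \<open>L\<^sub>J\<^sup>*\<close>, where \<open>B\<close> vanishes.
\<close>

lemma nabla_nabla:
  assumes x: "x \<in> csections E L" and y: "y \<in> csections E L" and z: "z \<in> csections E L"
  shows "nabla x (nabla y z) p = - B p (cdorfman E x (cdorfman E y (\<lambda>q. A q (z q))) p)"
proof -
  let ?w = "cdorfman E y (\<lambda>q. A q (z q))"
  have w: "?w \<in> csections E (cfibre E)" by (rule cdorfman_closed[OF y sharp_L_section[OF z]])
  have wc: "?w q \<in> cfibre E q" for q by (rule csections_on_mem[OF w UNIV_I])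
  have BAw: "(\<lambda>q. B q (A q (?w q))) \<in> csections E (Lstar_of E J)"
    by (intro conj_sharp_section csections_on_cfibreD[OF sharp_section] w)
  have "(\<lambda>q. A q (nabla y z q)) = (\<lambda>q. ?w q + B q (A q (?w q)))"
  proof
    fix q
    note Bc = conj_sharp_cfibre[OF wc[of q]]
    show "A q (nabla y z q) = ?w q + B q (A q (?w q))"
      using sharp_lin(3)[OF Bc Bc] Omega_sharp[OF wc[of q]]
      by (simp add: nabla_eq[OF y z], intro minus_unique) (simp add: add.left_commute)
  qed
  then have "nabla x (nabla y z) p = - B p (cdorfman E x (\<lambda>q. ?w q + B q (A q (?w q))) p)"
    unfolding nabla_eq[OF x nabla_closed[OF y z]] by simp
  also have "cdorfman E x (\<lambda>q. ?w q + B q (A q (?w q))) p = cdorfman E x ?w p + cdorfman E x (\<lambda>q. B q (A q (?w q))) p"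
    by (subst cdorfman_add_right[OF x w BAw]) (rule refl)
  also have "B p \<dots> = B p (cdorfman E x ?w p)"
    using conj_sharp_lin(1)[OF csections_on_mem[OF cdorfman_closed[OF x w] UNIV_I]
        csections_on_mem[OF cdorfman_closed[OF x BAw] UNIV_I]]
      conj_sharp_Lstar_of[OF csections_on_mem[OF Lstar_closed[OF csections_L_Lstar[OF x] BAw] UNIV_I]]
    by simp
  finally show ?thesis .
qed

lemma nabla_flat: "flat E L nabla"
  unfolding flat_def
proof (intro ballI ext)
  fix x y z p
  assume x: "x \<in> csections E L" and y: "y \<in> csections E L" and z: "z \<in> csections E L"
  note Az = sharp_L_section[OF z]
  let ?u = "cdorfman E (cdorfman E x y) (\<lambda>q. A q (z q)) p"
  let ?v = "cdorfman E y (cdorfman E x (\<lambda>q. A q (z q))) p"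
  have c: "?u \<in> cfibre E p" "?v \<in> cfibre E p"
    using csections_on_mem[OF cdorfman_closed[OF cdorfman_closed[OF x y] Az] UNIV_I]
      csections_on_mem[OF cdorfman_closed[OF y cdorfman_closed[OF x Az]] UNIV_I] .
  have "cdorfman E x (cdorfman E y (\<lambda>q. A q (z q))) p = ?u + ?v"
    using fun_cong[OF cdorfman_jacobi[OF x y Az]] .
  then show "nabla x (nabla y z) p - nabla y (nabla x z) p - nabla (cdorfman E x y) z p = 0"
    unfolding nabla_nabla[OF x y z] nabla_nabla[OF y x z] nabla_eq[OF L_closed[OF x y] z]
    by (simp add: conj_sharp_lin(1)[OF c])
qed

end

theorem theorem5p4:
  fixes E :: "('m::{second_countable_topology, t2_space}, 'c::real_inner, 'v::real_vector) courant"
    and J :: "'m \<Rightarrow> 'v \<Rightarrow> 'v"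
    and \<Omega> :: "'m \<Rightarrow> 'v \<times> 'v \<Rightarrow> 'v \<times> 'v \<Rightarrow> complex"
    and I K :: "'m \<Rightarrow> 'v \<times> 'v \<Rightarrow> 'v \<times> 'v"
    and L :: "'m \<Rightarrow> ('v \<times> 'v) set"
  assumes "courant_algebroid E"
    and "complex_structure E J"
    and "holomorphic_symplectic E J \<Omega>"
    and "I = (\<lambda>p u. sharp E \<Omega> p u + sharp E (conj_form \<Omega>) p u)"
    and "K = (\<lambda>p u. (- \<i>) *\<^sub>C (sharp E \<Omega> p u - sharp E (conj_form \<Omega>) p u))"
    and "lie_subalgebroid E (Lstar_of E J) L"
    and "lagrangian \<Omega> (Lstar_of E J) L"
  shows "algebroid_connection E L L (hypercomplex_connection E I (cextend J) K)
    \<and> torsion_free E L (hypercomplex_connection E I (cextend J) K)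
    \<and> flat E L (hypercomplex_connection E I (cextend J) K)"
proof -
  interpret holomorphic_symplectic E J \<Omega> by (rule assms(3))
  interpret lagrangian_subalgebroid E J \<Omega> L
    by unfold_locales (rule assms(6), rule assms(7))
  show ?thesis
    using nabla_connection nabla_torsion_free nabla_flat by (simp only: assms(4,5) nabla_def)
qed

end
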